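(* If $\mathfrak{A}$ is an AF algebra, then for any non-decreasing sequence of finite-dimensional C*-subalgebras $\mathcal{U}=(\mathfrak{A}_n)_{n\in\mathbb{N}}$ such that $\mathfrak{A}=\overline{\bigcup_{n\in\mathbb{N}}\mathfrak{A}_n}^{\|\cdot\|_{\mathfrak{A}}}$, the metric $\mathsf{m}_{i(\mathcal{U})}$ metrizes the Fell topology on $\mathrm{Ideal}(\mathfrak{A})$.
   Context: $\mathbb{N}=\{0,1,2,\dots\}$. AF algebras are not assumed unital. $\mathrm{Ideal}(\mathfrak{A})$ is the set of norm-closed two-sided ideals of $\mathfrak{A}$, including $\{0\}$ and $\mathfrak{A}$; $\mathrm{Prim}(\mathfrak{A})$ is the set of kernels of non-zero irreducible *-representations of $\mathfrak{A}$, with the Jacobson topology, whose closed sets are the sets $\{J\in\mathrm{Prim}(\mathfrak{A}): J\supseteq I\}$, $I\in\mathrm{Ideal}(\mathfrak{A})$. For a topological space $X$, let $\mathcal{C}l(X)$ be the set of its closed subsets; the Fell topology on $\mathcal{C}l(X)$ has as basis the sets $U(K,F)=\{Y\in\mathcal{C}l(X): Y\cap K=\emptyset \text{ and } Y\cap A\neq\emptyset \text{ for all } A\in F\}$, where $K\subseteq X$ is compact and $F$ is a finite family of non-empty open subsets of $X$. The Fell topology on $\mathrm{Ideal}(\mathfrak{A})$ is the initial topology induced by the bijection $I\in\mathrm{Ideal}(\mathfrak{A})\mapsto\{J\in\mathrm{Prim}(\mathfrak{A}):J\supseteq I\}\in\mathcal{C}l(\mathrm{Prim}(\mathfrak{A}))$.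 The metric $\mathsf{m}_{i(\mathcal{U})}$ on $\mathrm{Ideal}(\mathfrak{A})$ is defined by $\mathsf{m}_{i(\mathcal{U})}(I,J)=0$ if $I\cap\mathfrak{A}_n=J\cap\mathfrak{A}_n$ for all $n\in\mathbb{N}$, and $\mathsf{m}_{i(\mathcal{U})}(I,J)=2^{-\min\{m\in\mathbb{N}: I\cap\mathfrak{A}_m\neq J\cap\mathfrak{A}_m\}}$ otherwise. *)

theory Defs
  imports "HOL-Analysis.Analysis"
begin

subsection \<open>C*-algebras, ideals, AF algebras\<close>

text \<open>C*-algebras are complex and not assumed unital; the zero algebra is allowed.\<close>

class cstar_algebra = real_normed_algebra + banach +
  fixes scaleC :: "complex \<Rightarrow> 'a \<Rightarrow> 'a" (infixr "*\<^sub>C" 75)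
    and star :: "'a \<Rightarrow> 'a"
  assumes scaleC_add_right: "c *\<^sub>C (x + y) = c *\<^sub>C x + c *\<^sub>C y"
    and scaleC_add_left: "(c + d) *\<^sub>C x = c *\<^sub>C x + d *\<^sub>C x"
    and scaleC_scaleC: "c *\<^sub>C d *\<^sub>C x = (c * d) *\<^sub>C x"
    and scaleC_of_real: "complex_of_real r *\<^sub>C x = r *\<^sub>R x"
    and mult_scaleC_left: "(c *\<^sub>C x) * y = c *\<^sub>C (x * y)"
    and mult_scaleC_right: "x * (c *\<^sub>C y) = c *\<^sub>C (x * y)"
    and norm_scaleC: "norm (c *\<^sub>C x) = cmod c * norm x"
    and star_add: "star (x + y) = star x + star y"
    and star_scaleC: "star (c *\<^sub>C x) = cnj c *\<^sub>C star x"
    and star_mult: "star (x * y) = star y * star x"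
    and star_star: "star (star x) = x"
    and norm_star_mult: "norm (star x * x) = (norm x)\<^sup>2"

lemma scaleC_one: "1 *\<^sub>C x = (x :: 'a::cstar_algebra)"
  using scaleC_of_real[of 1 x] by simp

global_interpretation complex_vector:
  vector_space "scaleC :: complex \<Rightarrow> 'a \<Rightarrow> 'a::cstar_algebra"
  defines csubspace_raw_def: csubspace = complex_vector.subspace
    and cspan_raw_def: cspan = complex_vector.span
  by unfold_locales (simp_all add: scaleC_add_right scaleC_add_left scaleC_scaleC scaleC_one)

definition cstar_subalgebra :: "'a::cstar_algebra set \<Rightarrow> bool" where
  "cstar_subalgebra B \<longleftrightarrow>
     csubspace B \<and> (\<forall>x\<in>B. \<forall>y\<in>B. x * y \<in> B) \<and> (\<forall>x\<in>B. star x \<in> B) \<and> closed B"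

definition finite_dim :: "'a::cstar_algebra set \<Rightarrow> bool" where
  "finite_dim V \<longleftrightarrow> (\<exists>S. finite S \<and> V = cspan S)"

definition af_sequence :: "(nat \<Rightarrow> 'a::cstar_algebra set) \<Rightarrow> bool" where
  "af_sequence U \<longleftrightarrow>
     (\<forall>n. cstar_subalgebra (U n) \<and> finite_dim (U n)) \<and> incseq U \<and> closure (\<Union>n. U n) = UNIV"

definition af_algebra :: "'a::cstar_algebra itself \<Rightarrow> bool" where
  "af_algebra T \<longleftrightarrow> (\<exists>U :: nat \<Rightarrow> 'a set. af_sequence U)"

definition ideals :: "'a::cstar_algebra set set" where
  "ideals = {I. csubspace I \<and> (\<forall>a. \<forall>x\<in>I. a * x \<in> I \<and> x * a \<in> I) \<and> closed I}"

subsection \<open>Hilbert spaces and irreducible *-representations\<close>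

text \<open>
  The Hilbert space of a representation is existentially quantified in the definition of a
  primitive ideal, so it is given by an explicit carrier and explicit operations.
  The inner product is linear in its first argument.
\<close>

record 'h hspace =
  hcarrier :: "'h set"
  hadd :: "'h \<Rightarrow> 'h \<Rightarrow> 'h"
  hzero :: "'h"
  hscale :: "complex \<Rightarrow> 'h \<Rightarrow> 'h"
  hinner :: "'h \<Rightarrow> 'h \<Rightarrow> complex"

definition hnorm :: "'h hspace \<Rightarrow> 'h \<Rightarrow> real" where
  "hnorm H x = sqrt (Re (hinner H x x))"

text \<open>Off the carrier the value is irrelevant; 0 is chosen because \<^locale>\<open>Metric_space\<close>
  requires symmetry and non-negativity everywhere.\<close>

definition hdist :: "'h hspace \<Rightarrow> 'h \<Rightarrow> 'h \<Rightarrow> real" where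
  "hdist H x y =
     (if x \<in> hcarrier H \<and> y \<in> hcarrier H then hnorm H (hadd H x (hscale H (- 1) y)) else 0)"

locale hilbert_space =
  fixes H :: "'h hspace"
  assumes add_closed: "\<lbrakk>x \<in> hcarrier H; y \<in> hcarrier H\<rbrakk> \<Longrightarrow> hadd H x y \<in> hcarrier H"
    and add_assoc: "\<lbrakk>x \<in> hcarrier H; y \<in> hcarrier H; z \<in> hcarrier H\<rbrakk>
          \<Longrightarrow> hadd H (hadd H x y) z = hadd H x (hadd H y z)"
    and add_commute: "\<lbrakk>x \<in> hcarrier H; y \<in> hcarrier H\<rbrakk> \<Longrightarrow> hadd H x y = hadd H y x"
    and zero_closed: "hzero H \<in> hcarrier H"
    and add_zero: "x \<in> hcarrier H \<Longrightarrow> hadd H x (hzero H) = x"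
    and add_inverse: "x \<in> hcarrier H \<Longrightarrow> \<exists>y\<in>hcarrier H. hadd H x y = hzero H"
    and scale_closed: "x \<in> hcarrier H \<Longrightarrow> hscale H c x \<in> hcarrier H"
    and scale_add_right: "\<lbrakk>x \<in> hcarrier H; y \<in> hcarrier H\<rbrakk>
          \<Longrightarrow> hscale H c (hadd H x y) = hadd H (hscale H c x) (hscale H c y)"
    and scale_add_left: "x \<in> hcarrier H
          \<Longrightarrow> hscale H (c + d) x = hadd H (hscale H c x) (hscale H d x)"
    and scale_scale: "x \<in> hcarrier H \<Longrightarrow> hscale H c (hscale H d x) = hscale H (c * d) x"
    and scale_one: "x \<in> hcarrier H \<Longrightarrow> hscale H 1 x = x"
    and inner_add_left: "\<lbrakk>x \<in> hcarrier H; y \<in> hcarrier H; z \<in> hcarrier H\<rbrakk>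
          \<Longrightarrow> hinner H (hadd H x y) z = hinner H x z + hinner H y z"
    and inner_scale_left: "\<lbrakk>x \<in> hcarrier H; y \<in> hcarrier H\<rbrakk>
          \<Longrightarrow> hinner H (hscale H c x) y = c * hinner H x y"
    and inner_commute: "\<lbrakk>x \<in> hcarrier H; y \<in> hcarrier H\<rbrakk> \<Longrightarrow> hinner H x y = cnj (hinner H y x)"
    and inner_nonneg: "x \<in> hcarrier H \<Longrightarrow> 0 \<le> Re (hinner H x x)"
    and inner_definite: "\<lbrakk>x \<in> hcarrier H; hinner H x x = 0\<rbrakk> \<Longrightarrow> x = hzero H"
    and complete: "Metric_space.mcomplete (hcarrier H) (hdist H)"

definition closed_hsubspace :: "'h hspace \<Rightarrow> 'h set \<Rightarrow> bool" where
  "closed_hsubspace H M \<longleftrightarrow>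
     closedin (Metric_space.mtopology (hcarrier H) (hdist H)) M \<and> hzero H \<in> M \<and>
     (\<forall>x\<in>M. \<forall>y\<in>M. hadd H x y \<in> M) \<and> (\<forall>c. \<forall>x\<in>M. hscale H c x \<in> M)"

locale star_rep = hilbert_space H for H :: "'h hspace" +
  fixes \<pi> :: "'a::cstar_algebra \<Rightarrow> 'h \<Rightarrow> 'h"
  assumes rep_closed: "x \<in> hcarrier H \<Longrightarrow> \<pi> a x \<in> hcarrier H"
    and rep_add: "\<lbrakk>x \<in> hcarrier H; y \<in> hcarrier H\<rbrakk>
          \<Longrightarrow> \<pi> a (hadd H x y) = hadd H (\<pi> a x) (\<pi> a y)"
    and rep_scale: "x \<in> hcarrier H \<Longrightarrow> \<pi> a (hscale H c x) = hscale H c (\<pi> a x)"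
    and rep_bounded: "\<exists>K. \<forall>x\<in>hcarrier H. hnorm H (\<pi> a x) \<le> K * hnorm H x"
    and rep_plus: "x \<in> hcarrier H \<Longrightarrow> \<pi> (a + b) x = hadd H (\<pi> a x) (\<pi> b x)"
    and rep_scaleC: "x \<in> hcarrier H \<Longrightarrow> \<pi> (c *\<^sub>C a) x = hscale H c (\<pi> a x)"
    and rep_mult: "x \<in> hcarrier H \<Longrightarrow> \<pi> (a * b) x = \<pi> a (\<pi> b x)"
    and rep_star: "\<lbrakk>x \<in> hcarrier H; y \<in> hcarrier H\<rbrakk>
          \<Longrightarrow> hinner H (\<pi> (star a) x) y = hinner H x (\<pi> a y)"

definition rep_kernel :: "'h hspace \<Rightarrow> ('a::cstar_algebra \<Rightarrow> 'h \<Rightarrow> 'h) \<Rightarrow> 'a set" where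
  "rep_kernel H \<pi> = {a. \<forall>x\<in>hcarrier H. \<pi> a x = hzero H}"

definition irreducible_rep :: "'h hspace \<Rightarrow> ('a::cstar_algebra \<Rightarrow> 'h \<Rightarrow> 'h) \<Rightarrow> bool" where
  "irreducible_rep H \<pi> \<longleftrightarrow> star_rep H \<pi> \<and>
     (\<forall>M. closed_hsubspace H M \<and> (\<forall>a. \<forall>x\<in>M. \<pi> a x \<in> M) \<longrightarrow> M = {hzero H} \<or> M = hcarrier H)"

text \<open>
  Primitive ideals. One definition cannot quantify over Hilbert spaces of all types, so carriers
  are subsets of \<^typ>\<open>'a \<Rightarrow> complex\<close>, with arbitrary operations. Nothing is lost: a non-zero
  irreducible representation on a Hilbert space over any type has a cyclic vector \<open>\<eta>\<close>, and
  \<open>\<xi> \<mapsto> (\<lambda>a. \<langle>\<xi>, \<pi>(a)\<eta>\<rangle>)\<close> transports it to such a carrier; see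
  \<open>rep_kernel_in_Prim\<close> below.
\<close>

definition Prim :: "'a::cstar_algebra set set" where
  "Prim = {rep_kernel H \<pi> | (H :: ('a \<Rightarrow> complex) hspace) \<pi>.
             irreducible_rep H \<pi> \<and> rep_kernel H \<pi> \<noteq> UNIV}"

subsection \<open>Jacobson and Fell topologies\<close>

definition prim_hull :: "'a::cstar_algebra set \<Rightarrow> 'a set set" where
  "prim_hull I = {J \<in> Prim. I \<subseteq> J}"

definition jacobson_topology :: "'a::cstar_algebra set topology" where
  "jacobson_topology = topology (\<lambda>W. \<exists>I\<in>ideals. W = Prim - prim_hull I)"

definition fell_basic :: "'b topology \<Rightarrow> 'b set \<Rightarrow> 'b set set \<Rightarrow> 'b set set" where
  "fell_basic X K F = {Y. closedin X Y \<and> Y \<inter> K = {} \<and> (\<forall>A\<in>F. Y \<inter> A \<noteq> {})}"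

definition fell_topology :: "'b topology \<Rightarrow> 'b set topology" where
  "fell_topology X = topology (arbitrary union_of
     (\<lambda>W. \<exists>K F. compactin X K \<and> finite F \<and> (\<forall>A\<in>F. openin X A \<and> A \<noteq> {}) \<and>
                 W = fell_basic X K F))"

definition fell_ideal_topology :: "'a::cstar_algebra set topology" where
  "fell_ideal_topology = pullback_topology ideals prim_hull (fell_topology jacobson_topology)"

subsection \<open>The metric\<close>

definition ideal_metric :: "(nat \<Rightarrow> 'a::cstar_algebra set) \<Rightarrow> 'a set \<Rightarrow> 'a set \<Rightarrow> real" where
  "ideal_metric U I J =
     (if \<forall>n. I \<inter> U n = J \<inter> U n then 0 else 1 / 2 ^ (LEAST m. I \<inter> U m \<noteq> J \<inter> U m))"

subsection \<open>Adequacy of the definitions\<close>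

text \<open>
  The predicates passed to \<^const>\<open>topology\<close> above are topologies, with the expected closed sets
  (\<open>closedin_jacobson\<close>), base (\<open>openin_fell\<close>) and underlying sets (\<open>topspace_jacobson\<close>,
  \<open>topspace_fell\<close>, \<open>topspace_fell_ideal\<close>), and \<^const>\<open>Prim\<close> contains the kernels of the
  non-zero irreducible representations on all Hilbert spaces (\<open>rep_kernel_in_Prim\<close>).
\<close>

context hilbert_space
begin

lemma scale_zero: "x \<in> hcarrier H \<Longrightarrow> hscale H 0 x = hzero H"
proof -
  assume x: "x \<in> hcarrier H"
  let ?z = "hscale H 0 x"
  have z: "?z \<in> hcarrier H" using x by (rule scale_closed)
  obtain y where y: "y \<in> hcarrier H" "hadd H ?z y = hzero H" using add_inverse[OF z] by blast
  have "hadd H ?z ?z = ?z" using scale_add_left[OF x, of 0 0] by simp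
  then have "hzero H = hadd H (hadd H ?z ?z) y" using y by simp
  also have "\<dots> = hadd H ?z (hadd H ?z y)" using z y by (intro add_assoc)
  finally show ?thesis using y add_zero z by simp
qed

lemma scale_hzero: "hscale H c (hzero H) = hzero H"
  using scale_zero[OF zero_closed] scale_scale[OF zero_closed, of c 0] by simp

lemma add_uminus: "x \<in> hcarrier H \<Longrightarrow> hadd H x (hscale H (- 1) x) = hzero H"
  using scale_add_left[of x 1 "- 1"] scale_zero[of x] by (simp add: scale_one)

lemma zero_add: "x \<in> hcarrier H \<Longrightarrow> hadd H (hzero H) x = x"
  using add_commute add_zero zero_closed by metis

lemma eq_if_diff_zero:
  assumes "x \<in> hcarrier H" "y \<in> hcarrier H" "hadd H x (hscale H (- 1) y) = hzero H"
  shows "x = y"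
proof -
  have "x = hadd H x (hadd H (hscale H (- 1) y) y)"
    using assms add_uminus[of y] add_commute[of y "hscale H (- 1) y"] by (simp add: scale_closed add_zero)
  also have "\<dots> = hadd H (hadd H x (hscale H (- 1) y)) y"
    using assms by (intro add_assoc[symmetric] scale_closed)
  finally show ?thesis using assms zero_add by simp
qed

lemma inner_add_right:
  assumes "x \<in> hcarrier H" "y \<in> hcarrier H" "z \<in> hcarrier H"
  shows "hinner H z (hadd H x y) = hinner H z x + hinner H z y"
  using assms inner_commute[of z "hadd H x y"] inner_commute[of z x] inner_commute[of z y]
  by (simp add: add_closed inner_add_left)

lemma inner_scale_right:
  assumes "x \<in> hcarrier H" "y \<in> hcarrier H"
  shows "hinner H x (hscale H c y) = cnj c * hinner H x y"
  using assms inner_commute[of x "hscale H c y"] inner_commute[of x y]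
  by (simp add: scale_closed inner_scale_left)

lemma inner_self: "x \<in> hcarrier H \<Longrightarrow> hinner H x x = of_real ((hnorm H x)\<^sup>2)"
  using inner_nonneg[of x] inner_commute[of x x]
  by (simp add: hnorm_def complex_eq_iff)

lemma inner_zero_left: "x \<in> hcarrier H \<Longrightarrow> hinner H (hzero H) x = 0"
  using inner_scale_left[of x x 0] scale_zero[of x] by simp

lemma hnorm_nonneg: "x \<in> hcarrier H \<Longrightarrow> 0 \<le> hnorm H x"
  using inner_nonneg[of x] by (simp add: hnorm_def)

lemma hnorm_zero: "hnorm H (hzero H) = 0"
  by (simp add: hnorm_def inner_zero_left zero_closed)

lemma hnorm_eq_zero: "x \<in> hcarrier H \<Longrightarrow> hnorm H x = 0 \<longleftrightarrow> x = hzero H"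
  using inner_self[of x] inner_definite[of x] hnorm_zero by auto

lemma hnorm_scale: "x \<in> hcarrier H \<Longrightarrow> hnorm H (hscale H c x) = cmod c * hnorm H x"
proof -
  assume x: "x \<in> hcarrier H"
  have "hinner H (hscale H c x) (hscale H c x) = (c * cnj c) * hinner H x x"
    using x by (simp add: inner_scale_left inner_scale_right scale_closed)
  also have "\<dots> = of_real ((cmod c * hnorm H x)\<^sup>2)"
    unfolding complex_norm_square[symmetric] inner_self[OF x] of_real_mult[symmetric] power_mult_distrib ..
  finally have "Re (hinner H (hscale H c x) (hscale H c x)) = (cmod c * hnorm H x)\<^sup>2"
    by (simp only: Re_complex_of_real)
  then show ?thesis using x by (simp add: hnorm_def[of H "hscale H c x"] hnorm_nonneg)
qed

lemma inner_add_self: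
  assumes "x \<in> hcarrier H" "y \<in> hcarrier H"
  shows "(hnorm H (hadd H x y))\<^sup>2 = (hnorm H x)\<^sup>2 + 2 * Re (hinner H x y) + (hnorm H y)\<^sup>2"
proof -
  have "complex_of_real ((hnorm H (hadd H x y))\<^sup>2) = hinner H (hadd H x y) (hadd H x y)"
    using assms by (simp only: inner_self add_closed)
  also have "\<dots> = hinner H x x + (hinner H x y + cnj (hinner H x y)) + hinner H y y"
    using assms inner_commute[of y x] by (simp add: inner_add_left inner_add_right add_closed)
  also have "\<dots> = of_real ((hnorm H x)\<^sup>2 + 2 * Re (hinner H x y) + (hnorm H y)\<^sup>2)"
    using assms by (simp add: inner_self complex_add_cnj)
  finally show ?thesis using of_real_eq_iff by blast
qed

lemma Cauchy_Schwarz: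
  assumes x: "x \<in> hcarrier H" and y: "y \<in> hcarrier H"
  shows "cmod (hinner H x y) \<le> hnorm H x * hnorm H y"
proof (cases "y = hzero H")
  case True
  then show ?thesis using inner_zero_left[OF x] inner_commute[OF x y] by (simp add: hnorm_zero)
next
  case False
  define N where "N = (hnorm H y)\<^sup>2"
  define t where "t = - hinner H x y / of_real N"
  have N: "N > 0" using False hnorm_eq_zero[OF y] by (simp add: N_def)
  have ty: "hscale H t y \<in> hcarrier H" using y by (rule scale_closed)
  have "hinner H x (hscale H t y) = - of_real ((cmod (hinner H x y))\<^sup>2 / N)"
    using x y by (simp add: inner_scale_right t_def complex_norm_square mult.commute del: of_real_power)
  moreover have "(hnorm H (hscale H t y))\<^sup>2 = (cmod (hinner H x y))\<^sup>2 / N"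
    using N y by (simp add: hnorm_scale t_def norm_divide power_mult_distrib power_divide flip: N_def)
       (simp add: power2_eq_square)
  ultimately have "(hnorm H (hadd H x (hscale H t y)))\<^sup>2 = (hnorm H x)\<^sup>2 - (cmod (hinner H x y))\<^sup>2 / N"
    using inner_add_self[OF x ty] by (simp del: of_real_divide of_real_power)
  then have "(cmod (hinner H x y))\<^sup>2 / N \<le> (hnorm H x)\<^sup>2"
    by (smt (verit) zero_le_power2)
  then have "(cmod (hinner H x y))\<^sup>2 \<le> (hnorm H x * hnorm H y)\<^sup>2"
    using N by (simp add: divide_le_eq power_mult_distrib flip: N_def)
  then show ?thesis using x y by (meson hnorm_nonneg mult_nonneg_nonneg power2_le_imp_le)
qed

lemma hnorm_triangle:
  assumes x: "x \<in> hcarrier H" and y: "y \<in> hcarrier H"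
  shows "hnorm H (hadd H x y) \<le> hnorm H x + hnorm H y"
proof -
  have "Re (hinner H x y) \<le> hnorm H x * hnorm H y"
    using Cauchy_Schwarz[OF x y] complex_Re_le_cmod order_trans by blast
  then have "(hnorm H (hadd H x y))\<^sup>2 \<le> (hnorm H x + hnorm H y)\<^sup>2"
    by (simp add: inner_add_self[OF x y] power2_sum)
  then show ?thesis using x y by (meson hnorm_nonneg add_nonneg_nonneg power2_le_imp_le)
qed

abbreviation hdiff where "hdiff x y \<equiv> hadd H x (hscale H (- 1) y)"

lemma hdiff_closed: "x \<in> hcarrier H \<Longrightarrow> y \<in> hcarrier H \<Longrightarrow> hdiff x y \<in> hcarrier H"
  by (simp add: add_closed scale_closed)

lemma hdiff_flip:
  assumes "x \<in> hcarrier H" "y \<in> hcarrier H"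
  shows "hdiff y x = hscale H (- 1) (hdiff x y)"
  using assms by (simp add: scale_add_right scale_closed scale_scale scale_one add_commute)

lemma hdiff_trans:
  assumes "x \<in> hcarrier H" "y \<in> hcarrier H" "z \<in> hcarrier H"
  shows "hdiff x z = hadd H (hdiff x y) (hdiff y z)"
proof -
  let ?m = "hscale H (- 1)"
  have "hadd H (hdiff x y) (hdiff y z) = hadd H x (hadd H (?m y) (hadd H y (?m z)))"
    using assms by (intro add_assoc add_closed scale_closed)
  also have "hadd H (?m y) (hadd H y (?m z)) = hadd H (hadd H (?m y) y) (?m z)"
    using assms by (intro add_assoc[symmetric] scale_closed)
  also have "hadd H (?m y) y = hzero H"
    using assms add_uminus[of y] by (simp add: add_commute scale_closed)
  finally show ?thesis using assms by (simp add: zero_add scale_closed)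
qed

sublocale metric: Metric_space "hcarrier H" "hdist H"
proof
  show "0 \<le> hdist H x y" for x y
    by (simp add: hdist_def hdiff_closed hnorm_nonneg)
  show "hdist H x y = hdist H y x" for x y
  proof (cases "x \<in> hcarrier H \<and> y \<in> hcarrier H")
    case True
    then have "hnorm H (hdiff y x) = hnorm H (hdiff x y)"
      using hnorm_scale[OF hdiff_closed[of x y], of "- 1"] hdiff_flip[of x y] by (metis mult_1 norm_minus_cancel norm_one)
    then show ?thesis using True by (simp add: hdist_def)
  qed (auto simp: hdist_def)
  show "hdist H x y = 0 \<longleftrightarrow> x = y" if "x \<in> hcarrier H" "y \<in> hcarrier H" for x y
  proof -
    have "hdist H x y = 0 \<longleftrightarrow> hdiff x y = hzero H"
      using that by (simp add: hdist_def hnorm_eq_zero hdiff_closed)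
    then show ?thesis using that eq_if_diff_zero[of x y] add_uminus[of y] by blast
  qed
  show "hdist H x z \<le> hdist H x y + hdist H y z"
    if "x \<in> hcarrier H" "y \<in> hcarrier H" "z \<in> hcarrier H" for x y z
    using that hnorm_triangle[OF hdiff_closed[of x y] hdiff_closed[of y z]] by (simp only: hdist_def hdiff_trans[of x y z] if_True simp_thms)
qed

lemma closed_hsubspaceI:
  assumes "M \<subseteq> hcarrier H" "hzero H \<in> M"
    "\<And>x y. x \<in> M \<Longrightarrow> y \<in> M \<Longrightarrow> hadd H x y \<in> M" "\<And>c x. x \<in> M \<Longrightarrow> hscale H c x \<in> M"
    and lim: "\<And>\<sigma> l. range \<sigma> \<subseteq> M \<Longrightarrow> l \<in> hcarrier H \<Longrightarrow> (\<lambda>n. hdist H (\<sigma> n) l) \<longlonglongrightarrow> 0 \<Longrightarrow> l \<in> M"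
  shows "closed_hsubspace H M"
proof -
  have "closedin metric.mtopology M"
    unfolding metric.metric_closedin_iff_sequentially_closed
  proof (intro conjI allI impI assms(1))
    fix \<sigma> l assume s: "range \<sigma> \<subseteq> M \<and> limitin metric.mtopology \<sigma> l sequentially"
    then have l: "l \<in> hcarrier H" and
      e: "\<And>\<epsilon>. \<epsilon> > 0 \<Longrightarrow> \<exists>N. \<forall>n\<ge>N. hdist H (\<sigma> n) l < \<epsilon>"
      unfolding metric.limit_metric_sequentially by meson+
    have "(\<lambda>n. hdist H (\<sigma> n) l) \<longlonglongrightarrow> 0"
      by (rule LIMSEQ_I) (use e in simp)
    then show "l \<in> M" using lim s l by blast
  qed
  then show ?thesis using assms(2-4) unfolding closed_hsubspace_def by blast
qed

end


lemma norm_star: "norm (star a) = norm (a :: 'a::cstar_algebra)"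
proof -
  have le: "norm b \<le> norm (star b)" for b :: 'a
  proof (cases "b = 0")
    case False
    have "(norm b)\<^sup>2 \<le> norm (star b) * norm b"
      using norm_mult_ineq[of "star b" b] by (simp add: norm_star_mult)
    then show ?thesis using False by (simp add: power2_eq_square)
  qed simp
  show ?thesis using le[of a] le[of "star a"] by (simp add: star_star)
qed

lemma star_scaleR: "star (r *\<^sub>R a) = r *\<^sub>R star (a :: 'a::cstar_algebra)"
  using star_scaleC[of "of_real r" a] by (simp add: scaleC_of_real)

lemma star_diff: "star (a - b) = star a - star (b :: 'a::cstar_algebra)"
  using star_add[of "a - b" b] by simp

lemma ex_root_one_minus:
  fixes h :: "'a::cstar_algebra"
  assumes "star h = h" "norm h < 1"
  shows "\<exists>k. star k = k \<and> h = k + k - k * k"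
proof -
  define r where "r = 1 - sqrt (1 - norm h)"
  have r: "0 \<le> r" "r < 1" "(norm h + r\<^sup>2) / 2 = r"
    using assms(2) by (auto simp: r_def power2_diff)
  define S where "S = {k :: 'a. star k = k \<and> norm k \<le> r}"
  define T where "T k = (1 / 2) *\<^sub>R (h + k * k)" for k
  have "closed S"
    unfolding closed_sequential_limits
  proof (intro allI impI)
    fix x l assume x: "(\<forall>n. x n \<in> S) \<and> x \<longlonglongrightarrow> l"
    then have "norm l \<le> r"
      using Lim_norm_ubound[of sequentially x l r] by (simp add: S_def)
    have "(\<lambda>n. norm (star (x n) - star l)) \<longlonglongrightarrow> 0"
      using x by (simp add: star_diff[symmetric] norm_star LIM_zero tendsto_norm_zero)
    then have "(\<lambda>n. star (x n)) \<longlonglongrightarrow> star l"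
      by (rule Lim_null[THEN iffD2, OF tendsto_norm_zero_cancel])
    moreover have "(\<lambda>n. star (x n)) = x" using x by (auto simp: S_def)
    ultimately have "star l = l" using x LIMSEQ_unique by metis
    then show "l \<in> S" using \<open>norm l \<le> r\<close> by (simp add: S_def)
  qed
  moreover have "0 \<in> S" using r star_diff[of "0::'a" 0] by (simp add: S_def)
  moreover have "T ` S \<subseteq> S"
  proof
    fix y assume "y \<in> T ` S"
    then obtain k where k: "star k = k" "norm k \<le> r" "y = T k" by (auto simp: S_def)
    have "norm (h + k * k) \<le> norm h + r * r"
      using norm_triangle_ineq[of h "k * k"] norm_mult_ineq[of k k]
        mult_mono[OF k(2) k(2)] r by simp
    then have "norm y \<le> r" using r(3) k(3) by (simp add: T_def power2_eq_square)
    moreover have "star y = y" using k assms by (simp add: T_def star_scaleR star_add star_mult)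
    ultimately show "y \<in> S" by (simp add: S_def)
  qed
  moreover have "dist (T k) (T l) \<le> r * dist k l" if kl: "k \<in> S" "l \<in> S" for k l
  proof -
    have "T k - T l = (1 / 2) *\<^sub>R (k * (k - l) + (k - l) * l)"
      by (simp add: T_def algebra_simps)
    then have "norm (T k - T l) \<le> (norm (k * (k - l)) + norm ((k - l) * l)) / 2"
      using norm_triangle_ineq[of "k * (k - l)" "(k - l) * l"] by simp
    also have "\<dots> \<le> (r * norm (k - l) + norm (k - l) * r) / 2"
      using kl norm_mult_ineq[of k "k - l"] norm_mult_ineq[of "k - l" l]
        mult_right_mono[of "norm k" r "norm (k - l)"] mult_left_mono[of "norm l" r "norm (k - l)"]
      by (simp add: S_def mult.commute[of r])
    finally show ?thesis by (simp add: dist_norm)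
  qed
  ultimately have "\<exists>!k. k \<in> S \<and> T k = k"
    using Banach_fix[of S r T] r by (auto simp: complete_eq_closed)
  then obtain k where k: "star k = k" "T k = k" by (auto simp: S_def)
  have "2 *\<^sub>R T k = h + k * k" by (simp add: T_def)
  then have "h = k + k - k * k" using k(2) by (simp add: scaleR_2 algebra_simps)
  then show ?thesis using k by blast
qed

context star_rep
begin

lemma rep_hzero: "\<pi> a (hzero H) = hzero H"
  using rep_scale[OF zero_closed, of a 0] scale_zero[OF zero_closed] scale_zero[OF rep_closed[OF zero_closed]]
  by simp

lemma rep_0: "x \<in> hcarrier H \<Longrightarrow> \<pi> 0 x = hzero H"
  using rep_scaleC[of x 0 0] scale_zero[OF rep_closed[of x 0]] by simp

lemma rep_scaleR: "x \<in> hcarrier H \<Longrightarrow> \<pi> (r *\<^sub>R a) x = hscale H (of_real r) (\<pi> a x)"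
  by (simp only: scaleC_of_real[symmetric] rep_scaleC)

lemma rep_uminus: "x \<in> hcarrier H \<Longrightarrow> \<pi> (- a) x = hscale H (- 1) (\<pi> a x)"
  using rep_scaleR[of x "- 1" a] by simp

lemma rep_diff: "x \<in> hcarrier H \<Longrightarrow> \<pi> (a - b) x = hdiff (\<pi> a x) (\<pi> b x)"
  using rep_plus[of x a "- b"] by (simp add: rep_uminus)

lemma rep_hdiff:
  "x \<in> hcarrier H \<Longrightarrow> y \<in> hcarrier H \<Longrightarrow> \<pi> a (hdiff x y) = hdiff (\<pi> a x) (\<pi> a y)"
  by (simp add: rep_add rep_scale scale_closed)

lemma rep_star': "x \<in> hcarrier H \<Longrightarrow> y \<in> hcarrier H \<Longrightarrow>
    hinner H (\<pi> a x) y = hinner H x (\<pi> (star a) y)"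
  using rep_star[of x y "star a"] by (simp add: star_star)

lemma vector_kernel_limit:
  assumes s: "range \<sigma> \<subseteq> hcarrier H" and l: "l \<in> hcarrier H"
    and lim: "(\<lambda>n. hdist H (\<sigma> n) l) \<longlonglongrightarrow> 0" and z: "\<And>n. \<pi> a (\<sigma> n) = hzero H"
  shows "\<pi> a l = hzero H"
proof -
  obtain K where K: "\<And>x. x \<in> hcarrier H \<Longrightarrow> hnorm H (\<pi> a x) \<le> K * hnorm H x"
    using rep_bounded by blast
  have "hnorm H (\<pi> a l) \<le> K * hdist H (\<sigma> n) l" for n
  proof -
    have sn: "\<sigma> n \<in> hcarrier H" using s by auto
    have "\<pi> a (hdiff (\<sigma> n) l) = hscale H (- 1) (\<pi> a l)"
      using sn l by (simp only: rep_hdiff z zero_add scale_closed rep_closed)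
    then have "hnorm H (\<pi> a l) = hnorm H (\<pi> a (hdiff (\<sigma> n) l))"
      using l by (simp add: hnorm_scale rep_closed)
    then show ?thesis using K[OF hdiff_closed[OF sn l]] sn l by (simp add: hdist_def)
  qed
  moreover have "(\<lambda>n. K * hdist H (\<sigma> n) l) \<longlonglongrightarrow> 0"
    using tendsto_mult_left[OF lim, of K] by simp
  ultimately have "hnorm H (\<pi> a l) \<le> 0"
    by (meson LIMSEQ_le_const)
  then show ?thesis using hnorm_nonneg hnorm_eq_zero rep_closed l by (meson antisym)
qed

lemma inner_limit:
  assumes s: "range \<sigma> \<subseteq> hcarrier H" and l: "l \<in> hcarrier H" and y: "y \<in> hcarrier H"
    and lim: "(\<lambda>n. hdist H (\<sigma> n) l) \<longlonglongrightarrow> 0" and z: "\<And>n. hinner H (\<sigma> n) y = 0"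
  shows "hinner H l y = 0"
proof -
  have "cmod (hinner H l y) \<le> hdist H (\<sigma> n) l * hnorm H y" for n
  proof -
    have sn: "\<sigma> n \<in> hcarrier H" using s by auto
    have "hinner H (hdiff (\<sigma> n) l) y = - hinner H l y"
      using sn l y z by (simp add: inner_add_left inner_scale_left scale_closed)
    then have "cmod (hinner H l y) = cmod (hinner H (hdiff (\<sigma> n) l) y)" by simp
    also have "\<dots> \<le> hdist H (\<sigma> n) l * hnorm H y"
      using Cauchy_Schwarz[OF hdiff_closed[OF sn l] y] sn l by (simp add: hdist_def)
    finally show ?thesis .
  qed
  moreover have "(\<lambda>n. hdist H (\<sigma> n) l * hnorm H y) \<longlonglongrightarrow> 0"
    using tendsto_mult_right[OF lim, of "hnorm H y"] by simp
  ultimately have "cmod (hinner H l y) \<le> 0"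
    by (meson LIMSEQ_le_const)
  then show ?thesis by simp
qed

lemma rep_contractive:
  assumes x: "x \<in> hcarrier H"
  shows "hnorm H (\<pi> a x) \<le> norm a * hnorm H x"
proof -
  have "(hnorm H (\<pi> a x))\<^sup>2 \<le> s * (hnorm H x)\<^sup>2" if s: "s > (norm a)\<^sup>2" for s
  proof -
    have s0: "s > 0" using s zero_le_power2[of "norm a"] by linarith
    define h where "h = (1 / s) *\<^sub>R (star a * a)"
    have "star h = h" by (simp add: h_def star_scaleR star_mult star_star)
    moreover have "norm h < 1" using s s0 by (simp add: h_def norm_star_mult)
    ultimately obtain k where k: "star k = k" "h = k + k - k * k"
      using ex_root_one_minus by blast
    let ?y = "\<pi> k x"
    have y: "?y \<in> hcarrier H" using x by (rule rep_closed)
    have "0 \<le> (hnorm H (hdiff x ?y))\<^sup>2" by simp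
    also have "\<dots> = (hnorm H x)\<^sup>2 - 2 * Re (hinner H x ?y) + (hnorm H ?y)\<^sup>2"
      using x y inner_add_self[of x "hscale H (- 1) ?y"]
      by (simp add: scale_closed inner_scale_right hnorm_scale)
    finally have 1: "0 \<le> (hnorm H x)\<^sup>2 - 2 * Re (hinner H x ?y) + (hnorm H ?y)\<^sup>2" .
    have "complex_of_real ((hnorm H ?y)\<^sup>2) = hinner H x (\<pi> (k * k) x)"
      using x y k(1) by (simp add: inner_self[symmetric] rep_star' rep_mult del: of_real_power)
    then have 2: "(hnorm H ?y)\<^sup>2 = Re (hinner H x (\<pi> (k * k) x))"
      by (metis Re_complex_of_real)
    have "\<pi> h x = hdiff (hadd H ?y ?y) (\<pi> (k * k) x)"
      using x by (simp add: k(2) rep_diff rep_plus)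
    then have 3: "Re (hinner H x (\<pi> h x)) = 2 * Re (hinner H x ?y) - Re (hinner H x (\<pi> (k * k) x))"
      using x y by (simp add: inner_add_right inner_scale_right add_closed scale_closed rep_closed)
    have "\<pi> h x = hscale H (of_real (1 / s)) (\<pi> (star a) (\<pi> a x))"
      using x unfolding h_def by (simp only: rep_scaleR rep_mult)
    then have "hinner H x (\<pi> h x) = of_real (1 / s) * hinner H (\<pi> a x) (\<pi> a x)"
      using x by (simp add: inner_scale_right rep_closed rep_star')
    then have "Re (hinner H x (\<pi> h x)) = (hnorm H (\<pi> a x))\<^sup>2 / s"
      unfolding inner_self[OF rep_closed[OF x]] of_real_mult[symmetric] by simp
    then have "(hnorm H (\<pi> a x))\<^sup>2 / s \<le> (hnorm H x)\<^sup>2" using 1 2 3 by linarith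
    then show ?thesis using s0 by (simp add: divide_le_eq mult.commute)
  qed
  then have "(hnorm H (\<pi> a x))\<^sup>2 \<le> (norm a)\<^sup>2 * (hnorm H x)\<^sup>2"
  proof -
    assume *: "\<And>s. (norm a)\<^sup>2 < s \<Longrightarrow> (hnorm H (\<pi> a x))\<^sup>2 \<le> s * (hnorm H x)\<^sup>2"
    have "(\<lambda>n. ((norm a)\<^sup>2 + inverse (real (Suc n))) * (hnorm H x)\<^sup>2)
        \<longlonglongrightarrow> ((norm a)\<^sup>2 + 0) * (hnorm H x)\<^sup>2"
      by (intro tendsto_intros LIMSEQ_inverse_real_of_nat)
    then have "(hnorm H (\<pi> a x))\<^sup>2 \<le> ((norm a)\<^sup>2 + 0) * (hnorm H x)\<^sup>2"
      by (rule LIMSEQ_le_const) (use * in simp)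
    then show ?thesis by simp
  qed
  then have "(hnorm H (\<pi> a x))\<^sup>2 \<le> (norm a * hnorm H x)\<^sup>2" by (simp add: power_mult_distrib)
  then show ?thesis using x by (meson hnorm_nonneg mult_nonneg_nonneg norm_ge_zero power2_le_imp_le)
qed

lemma rep_kernel_in_ideals: "rep_kernel H \<pi> \<in> ideals"
proof -
  have "csubspace (rep_kernel H \<pi>)"
    unfolding complex_vector.subspace_def rep_kernel_def
    by (auto simp: rep_0 rep_plus rep_scaleC scale_hzero zero_add zero_closed)
  moreover have "closed (rep_kernel H \<pi>)"
    unfolding closed_sequential_limits
  proof (intro allI impI)
    fix a l assume a: "(\<forall>n. a n \<in> rep_kernel H \<pi>) \<and> a \<longlonglongrightarrow> l"
    have "\<pi> l x = hzero H" if x: "x \<in> hcarrier H" for x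
    proof -
      have "hnorm H (\<pi> l x) \<le> norm (l - a n) * hnorm H x" for n
      proof -
        have "\<pi> (l - a n) x = \<pi> l x"
          using a x by (simp add: rep_diff rep_kernel_def scale_hzero add_zero rep_closed)
        then show ?thesis using rep_contractive[OF x, of "l - a n"] by simp
      qed
      moreover have "(\<lambda>n. norm (l - a n) * hnorm H x) \<longlonglongrightarrow> norm (l - l) * hnorm H x"
        using a by (intro tendsto_intros) auto
      ultimately have "hnorm H (\<pi> l x) \<le> norm (l - l) * hnorm H x"
        by (meson LIMSEQ_le_const)
      then have "hnorm H (\<pi> l x) \<le> 0" by simp
      then show ?thesis using hnorm_nonneg hnorm_eq_zero rep_closed x by (meson antisym)
    qed
    then show "l \<in> rep_kernel H \<pi>" by (simp add: rep_kernel_def)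
  qed
  ultimately show ?thesis
    by (auto simp: ideals_def rep_kernel_def rep_mult rep_hzero rep_closed)
qed

end

lemma rep_kernel_prime:
  assumes irr: "irreducible_rep H \<pi>" and I: "I \<in> ideals" and K: "K \<in> ideals"
    and sub: "I \<inter> K \<subseteq> rep_kernel H \<pi>"
  shows "I \<subseteq> rep_kernel H \<pi> \<or> K \<subseteq> rep_kernel H \<pi>"
proof -
  interpret star_rep H \<pi> using irr by (simp add: irreducible_rep_def)
  define N where "N = {x \<in> hcarrier H. \<forall>a\<in>K. \<pi> a x = hzero H}"
  have "closed_hsubspace H N"
  proof (rule closed_hsubspaceI)
    show "l \<in> N" if "range \<sigma> \<subseteq> N" "l \<in> hcarrier H" "(\<lambda>n. hdist H (\<sigma> n) l) \<longlonglongrightarrow> 0" for \<sigma> l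
      using that vector_kernel_limit[of \<sigma> l] by (auto simp: N_def image_subset_iff)
  qed (auto simp: N_def zero_closed rep_hzero add_closed scale_closed rep_add rep_scale
        zero_add scale_hzero)
  moreover have "\<pi> b x \<in> N" if "x \<in> N" for b x
    using that K by (auto simp: N_def rep_closed ideals_def rep_mult[symmetric])
  ultimately have "N = {hzero H} \<or> N = hcarrier H"
    using irr by (auto simp: irreducible_rep_def)
  then show ?thesis
  proof
    assume N: "N = {hzero H}"
    have "\<pi> b x \<in> N" if "b \<in> I" "x \<in> hcarrier H" for b x
    proof -
      have "a * b \<in> I \<inter> K" if "a \<in> K" for a using that \<open>b \<in> I\<close> I K by (auto simp: ideals_def)
      then show ?thesis using sub that
        by (auto simp: N_def rep_closed rep_mult[symmetric] rep_kernel_def)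
    qed
    then show ?thesis using N by (auto simp: rep_kernel_def)
  next
    assume "N = hcarrier H"
    then show ?thesis by (auto simp: N_def rep_kernel_def)
  qed
qed


lemma Prim_subset_ideals: "Prim \<subseteq> ideals"
  using star_rep.rep_kernel_in_ideals by (auto simp: Prim_def irreducible_rep_def)

lemma Int_ideals: "I \<in> ideals \<Longrightarrow> K \<in> ideals \<Longrightarrow> I \<inter> K \<in> ideals"
  by (auto simp: ideals_def complex_vector.subspace_inter)

lemma Inter_ideals: "\<A> \<subseteq> ideals \<Longrightarrow> \<Inter>\<A> \<in> ideals"
proof -
  assume A: "\<A> \<subseteq> ideals"
  have "csubspace (\<Inter>\<A>)" using A by (intro complex_vector.subspace_Inter) (auto simp: ideals_def)
  moreover have "closed (\<Inter>\<A>)" using A by (intro closed_Inter) (auto simp: ideals_def)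
  ultimately show ?thesis using A by (auto simp: ideals_def)
qed

lemma prim_hull_Int:
  fixes I K :: "'a::cstar_algebra set"
  assumes "I \<in> ideals" "K \<in> ideals"
  shows "prim_hull (I \<inter> K) = prim_hull I \<union> prim_hull K"
proof (rule equalityI)
  show "prim_hull (I \<inter> K) \<subseteq> prim_hull I \<union> prim_hull K"
  proof
    fix J assume "J \<in> prim_hull (I \<inter> K)"
    then have J: "J \<in> Prim" "I \<inter> K \<subseteq> J" by (simp_all add: prim_hull_def)
    then obtain H \<pi> where "irreducible_rep (H :: ('a \<Rightarrow> complex) hspace) \<pi>" "J = rep_kernel H \<pi>"
      unfolding Prim_def by blast
    then show "J \<in> prim_hull I \<union> prim_hull K"
      using J rep_kernel_prime[OF _ assms] by (auto simp: prim_hull_def)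
  qed
qed (auto simp: prim_hull_def)

lemma istopology_jacobson: "istopology (\<lambda>W. \<exists>I\<in>ideals. W = Prim - prim_hull (I :: 'a::cstar_algebra set))"
  unfolding istopology_def
proof (intro conjI allI impI)
  fix S T :: "'a set set"
  assume "\<exists>I\<in>ideals. S = Prim - prim_hull I" "\<exists>I\<in>ideals. T = Prim - prim_hull I"
  then obtain I K where "I \<in> ideals" "S = Prim - prim_hull I" "K \<in> ideals" "T = Prim - prim_hull K"
    by blast
  then show "\<exists>I\<in>ideals. S \<inter> T = Prim - prim_hull I"
    by (intro bexI[of _ "I \<inter> K"]) (auto simp: prim_hull_Int Int_ideals)
next
  fix \<K> :: "'a set set set"
  assume K: "\<forall>W\<in>\<K>. \<exists>I\<in>ideals. W = Prim - prim_hull I"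
  define \<I> where "\<I> = {I \<in> ideals. Prim - prim_hull I \<in> \<K>}"
  define L where "L = \<Inter>{J \<in> ideals. \<Union>\<I> \<subseteq> J}"
  have "L \<in> ideals" unfolding L_def by (rule Inter_ideals) auto
  moreover have "prim_hull L = {J \<in> Prim. \<forall>I\<in>\<I>. I \<subseteq> J}"
    using Prim_subset_ideals unfolding prim_hull_def L_def by blast
  then have "\<Union>\<K> = Prim - prim_hull L"
  proof -
    assume L: "prim_hull L = {J \<in> Prim. \<forall>I\<in>\<I>. I \<subseteq> J}"
    have "\<Union>\<K> = (\<Union>I\<in>\<I>. Prim - prim_hull I)"
    proof (rule equalityI)
      show "\<Union>\<K> \<subseteq> (\<Union>I\<in>\<I>. Prim - prim_hull I)"
      proof
        fix J assume "J \<in> \<Union>\<K>"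
        then obtain W where W: "W \<in> \<K>" "J \<in> W" by blast
        then obtain I where "I \<in> ideals" "W = Prim - prim_hull I" using K by blast
        then show "J \<in> (\<Union>I\<in>\<I>. Prim - prim_hull I)" using W by (auto simp: \<I>_def)
      qed
    qed (auto simp: \<I>_def)
    also have "\<dots> = Prim - prim_hull L" unfolding L by (auto simp: prim_hull_def)
    finally show ?thesis .
  qed
  ultimately show "\<exists>I\<in>ideals. \<Union>\<K> = Prim - prim_hull I" by blast
qed

lemma openin_jacobson: "openin jacobson_topology W \<longleftrightarrow> (\<exists>I\<in>ideals. W = Prim - prim_hull I)"
  by (simp add: jacobson_topology_def topology_inverse'[OF istopology_jacobson])

lemma topspace_jacobson: "topspace jacobson_topology = (Prim :: 'a::cstar_algebra set set)"
proof -
  have "(UNIV :: 'a set) \<in> ideals" by (simp add: ideals_def)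
  moreover have "prim_hull (UNIV :: 'a set) = {}" by (auto simp: prim_hull_def Prim_def)
  ultimately have "openin jacobson_topology (Prim :: 'a set set)"
    unfolding openin_jacobson by (metis Diff_empty)
  then show ?thesis by (auto simp: topspace_def openin_jacobson)
qed

lemma closedin_jacobson: "closedin jacobson_topology (C :: 'a::cstar_algebra set set) \<longleftrightarrow> (\<exists>I\<in>ideals. C = prim_hull I)"
proof -
  have sub: "prim_hull I \<subseteq> Prim" for I :: "'a set" by (auto simp: prim_hull_def)
  have "C \<subseteq> Prim \<and> Prim - C = Prim - prim_hull I \<longleftrightarrow> C = prim_hull I" for I
    using sub[of I] by blast
  then show ?thesis unfolding closedin_def topspace_jacobson openin_jacobson by blast
qed

lemma openin_fell: "openin (fell_topology X) =
  arbitrary union_of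
     (\<lambda>W. \<exists>K F. compactin X K \<and> finite F \<and> (\<forall>A\<in>F. openin X A \<and> A \<noteq> {}) \<and>
                 W = fell_basic X K F)"
  unfolding fell_topology_def
proof (rule topology_inverse', rule istopology_base, elim exE conjE)
  fix S T K F K' F'
  assume "compactin X K" "finite F" "\<forall>A\<in>F. openin X A \<and> A \<noteq> {}" "S = fell_basic X K F"
    "compactin X K'" "finite F'" "\<forall>A\<in>F'. openin X A \<and> A \<noteq> {}" "T = fell_basic X K' F'"
  then show "\<exists>K F. compactin X K \<and> finite F \<and> (\<forall>A\<in>F. openin X A \<and> A \<noteq> {}) \<and>
      S \<inter> T = fell_basic X K F"
    by (intro exI[of _ "K \<union> K'"] exI[of _ "F \<union> F'"]) (auto simp: fell_basic_def compactin_Un)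
qed

lemma topspace_fell: "topspace (fell_topology X) = Collect (closedin X)"
proof
  show "topspace (fell_topology X) \<subseteq> Collect (closedin X)"
    by (auto simp: topspace_def openin_fell union_of_def arbitrary_def fell_basic_def)
  have "openin (fell_topology X) (fell_basic X {} {})"
    unfolding openin_fell by (intro arbitrary_union_of_inc exI[of _ "{}"]) auto
  then show "Collect (closedin X) \<subseteq> topspace (fell_topology X)"
    using openin_subset by (fastforce simp: fell_basic_def)
qed

lemma topspace_fell_ideal: "topspace fell_ideal_topology = ideals"
  unfolding fell_ideal_topology_def topspace_pullback_topology topspace_fell
  using closedin_jacobson by blast

definition transport_space :: "'h hspace \<Rightarrow> ('h \<Rightarrow> 'k) \<Rightarrow> 'k hspace" where
  "transport_space H f = (let g = inv_into (hcarrier H) f in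
     \<lparr>hcarrier = f ` hcarrier H, hadd = (\<lambda>u v. f (hadd H (g u) (g v))), hzero = f (hzero H),
      hscale = (\<lambda>c u. f (hscale H c (g u))), hinner = (\<lambda>u v. hinner H (g u) (g v))\<rparr>)"

definition transport_rep :: "'h hspace \<Rightarrow> ('h \<Rightarrow> 'k) \<Rightarrow> ('a \<Rightarrow> 'h \<Rightarrow> 'h) \<Rightarrow> 'a \<Rightarrow> 'k \<Rightarrow> 'k" where
  "transport_rep H f \<pi> = (\<lambda>a u. f (\<pi> a (inv_into (hcarrier H) f u)))"

context
  fixes H :: "'h hspace" and f :: "'h \<Rightarrow> 'k"
  assumes inj: "inj_on f (hcarrier H)" and hs: "hilbert_space H"
begin

interpretation hilbert_space H by (rule hs)

lemma transport_simps:
  "hcarrier (transport_space H f) = f ` hcarrier H"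
  "hzero (transport_space H f) = f (hzero H)"
  "x \<in> hcarrier H \<Longrightarrow> y \<in> hcarrier H \<Longrightarrow> hadd (transport_space H f) (f x) (f y) = f (hadd H x y)"
  "x \<in> hcarrier H \<Longrightarrow> hscale (transport_space H f) c (f x) = f (hscale H c x)"
  "x \<in> hcarrier H \<Longrightarrow> y \<in> hcarrier H \<Longrightarrow> hinner (transport_space H f) (f x) (f y) = hinner H x y"
  "x \<in> hcarrier H \<Longrightarrow> hnorm (transport_space H f) (f x) = hnorm H x"
  "x \<in> hcarrier H \<Longrightarrow> transport_rep H f \<pi> a (f x) = f (\<pi> a x)"
  using inj by (simp_all add: transport_space_def transport_rep_def hnorm_def Let_def)

lemma transport_hdist:
  "x \<in> hcarrier H \<Longrightarrow> y \<in> hcarrier H \<Longrightarrow> hdist (transport_space H f) (f x) (f y) = hdist H x y"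
  by (simp add: hdist_def transport_simps scale_closed add_closed)

lemma transport_seq:
  assumes "range \<sigma> \<subseteq> f ` hcarrier H"
  obtains \<tau> where "range \<tau> \<subseteq> hcarrier H" "\<sigma> = (\<lambda>n. f (\<tau> n))"
proof -
  have "\<forall>n. \<exists>x\<in>hcarrier H. \<sigma> n = f x" using assms by (auto simp: image_subset_iff)
  then obtain \<tau> where "\<forall>n. \<tau> n \<in> hcarrier H \<and> \<sigma> n = f (\<tau> n)" by metis
  then show ?thesis by (intro that[of \<tau>]) auto
qed

lemma transport_metric: "Metric_space (f ` hcarrier H) (hdist (transport_space H f))"
proof
  fix u v
  show "0 \<le> hdist (transport_space H f) u v"
    by (auto simp: hdist_def transport_simps hnorm_nonneg scale_closed add_closed)
  show "hdist (transport_space H f) u v = hdist (transport_space H f) v u"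
  proof (cases "u \<in> f ` hcarrier H \<and> v \<in> f ` hcarrier H")
    case True
    then show ?thesis using metric.commute by (auto simp: transport_hdist)
  qed (auto simp: hdist_def transport_simps)
next
  show "(hdist (transport_space H f) u v = 0) = (u = v)"
    if "u \<in> f ` hcarrier H" "v \<in> f ` hcarrier H" for u v
    using that inj by (auto simp: transport_hdist inj_on_eq_iff)
  show "hdist (transport_space H f) u w \<le> hdist (transport_space H f) u v + hdist (transport_space H f) v w"
    if "u \<in> f ` hcarrier H" "v \<in> f ` hcarrier H" "w \<in> f ` hcarrier H" for u v w
    using that metric.triangle by (auto simp: transport_hdist)
qed

interpretation tm: Metric_space "f ` hcarrier H" "hdist (transport_space H f)"
  by (rule transport_metric)

lemma transport_hilbert: "hilbert_space (transport_space H f)"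
proof
  show "Metric_space.mcomplete (hcarrier (transport_space H f)) (hdist (transport_space H f))"
    unfolding transport_simps tm.mcomplete_def
  proof (intro allI impI)
    fix \<sigma> assume \<sigma>: "tm.MCauchy \<sigma>"
    then have "range \<sigma> \<subseteq> f ` hcarrier H" by (simp add: tm.MCauchy_def)
    then obtain \<tau> where \<tau>: "range \<tau> \<subseteq> hcarrier H" "\<sigma> = (\<lambda>n. f (\<tau> n))" by (rule transport_seq)
    then have t: "\<tau> n \<in> hcarrier H" for n by auto
    have "metric.MCauchy \<tau>" using \<sigma> \<tau> t by (simp add: tm.MCauchy_def metric.MCauchy_def transport_hdist)
    then obtain l where "limitin metric.mtopology \<tau> l sequentially"
      using complete metric.mcomplete_def by blast
    then have "limitin tm.mtopology \<sigma> (f l) sequentially"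
      using t \<tau> by (auto simp: tm.limit_metric_sequentially metric.limit_metric_sequentially transport_hdist)
    then show "\<exists>l. limitin tm.mtopology \<sigma> l sequentially" by blast
  qed
  show "\<exists>y\<in>hcarrier (transport_space H f). hadd (transport_space H f) x y = hzero (transport_space H f)"
    if "x \<in> hcarrier (transport_space H f)" for x
  proof -
    obtain x' where x': "x' \<in> hcarrier H" "x = f x'" using \<open>x \<in> _\<close> by (auto simp: transport_simps)
    then obtain y where "y \<in> hcarrier H" "hadd H x' y = hzero H" using add_inverse by blast
    then show ?thesis using x' by (auto simp: transport_simps intro!: bexI[of _ y])
  qed
  show "hinner (transport_space H f) x y = cnj (hinner (transport_space H f) y x)"
    if xy: "x \<in> hcarrier (transport_space H f)" "y \<in> hcarrier (transport_space H f)" for x y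
  proof -
    obtain x' y' where "x' \<in> hcarrier H" "x = f x'" "y' \<in> hcarrier H" "y = f y'"
      using xy unfolding transport_simps by blast
    then show ?thesis using inner_commute[of x' y'] by (simp only: transport_simps)
  qed
  show "x = hzero (transport_space H f)"
    if "x \<in> hcarrier (transport_space H f)" "hinner (transport_space H f) x x = 0" for x
  proof -
    obtain x' where x': "x' \<in> hcarrier H" "x = f x'" using \<open>x \<in> _\<close> by (auto simp: transport_simps)
    then have "hinner H x' x' = 0" using that by (simp add: transport_simps)
    then show ?thesis using x' inner_definite[of x'] by (simp add: transport_simps)
  qed
  show "hadd (transport_space H f) x y = hadd (transport_space H f) y x"
    if xy: "x \<in> hcarrier (transport_space H f)" "y \<in> hcarrier (transport_space H f)" for x y
  proof -
    obtain x' y' where "x' \<in> hcarrier H" "x = f x'" "y' \<in> hcarrier H" "y = f y'"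
      using xy unfolding transport_simps by blast
    then show ?thesis using add_commute[of x' y'] by (simp only: transport_simps)
  qed
qed (auto simp: transport_simps add_closed scale_closed zero_closed add_zero add_assoc scale_add_right
     scale_add_left scale_scale scale_one inner_add_left inner_scale_left inner_nonneg)

lemma transport_closed_hsubspace:
  assumes "closed_hsubspace (transport_space H f) M"
  obtains N where "closed_hsubspace H N" "M = f ` N"
proof
  define N where "N = {x \<in> hcarrier H. f x \<in> M}"
  have M: "closedin tm.mtopology M" using assms by (simp add: closed_hsubspace_def transport_simps)
  then have "M \<subseteq> f ` hcarrier H" using closedin_subset[OF M] by simp
  then show "M = f ` N" by (auto simp: N_def)
  show "closed_hsubspace H N"
  proof (rule closed_hsubspaceI)
    fix \<sigma> l assume s: "range \<sigma> \<subseteq> N" and l: "l \<in> hcarrier H" and lim: "(\<lambda>n. hdist H (\<sigma> n) l) \<longlonglongrightarrow> 0"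
    have t: "\<sigma> n \<in> hcarrier H" "f (\<sigma> n) \<in> M" for n using s by (auto simp: N_def)
    have "\<exists>N. \<forall>n\<ge>N. hdist H (\<sigma> n) l < e" if "e > 0" for e
      using LIMSEQ_D[OF lim that] by simp
    then have "limitin tm.mtopology (\<lambda>n. f (\<sigma> n)) (f l) sequentially"
      using t l by (simp add: tm.limit_metric_sequentially transport_hdist)
    moreover have "range (\<lambda>n. f (\<sigma> n)) \<subseteq> M" using t by blast
    moreover have "\<And>\<tau> u. range \<tau> \<subseteq> M \<and> limitin tm.mtopology \<tau> u sequentially \<Longrightarrow> u \<in> M"
      using M unfolding tm.metric_closedin_iff_sequentially_closed by iprover
    ultimately have "f l \<in> M" by meson
    then show "l \<in> N" using l by (simp add: N_def)
  next
    show "hadd H x y \<in> N" if "x \<in> N" "y \<in> N" for x y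
    proof -
      have "hadd (transport_space H f) (f x) (f y) \<in> M"
        using that assms unfolding N_def closed_hsubspace_def by blast
      then show ?thesis using that by (simp add: N_def transport_simps add_closed)
    qed
    show "hscale H c x \<in> N" if "x \<in> N" for c x
    proof -
      have "hscale (transport_space H f) c (f x) \<in> M"
        using that assms unfolding N_def closed_hsubspace_def by blast
      then show ?thesis using that by (simp add: N_def transport_simps scale_closed)
    qed
    show "hzero H \<in> N"
      using assms unfolding N_def closed_hsubspace_def transport_simps by (simp add: zero_closed)
  qed (auto simp: N_def)
qed

lemma transport_irreducible:
  assumes irr: "irreducible_rep H \<pi>"
  shows "irreducible_rep (transport_space H f) (transport_rep H f \<pi>)"
    and "rep_kernel (transport_space H f) (transport_rep H f \<pi>) = rep_kernel H \<pi>"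
proof -
  interpret star_rep H \<pi> using irr by (simp add: irreducible_rep_def)
  interpret t: hilbert_space "transport_space H f" by (rule transport_hilbert)
  have "star_rep (transport_space H f) (transport_rep H f \<pi>)"
  proof
    show "\<exists>K. \<forall>x\<in>hcarrier (transport_space H f).
        hnorm (transport_space H f) (transport_rep H f \<pi> a x) \<le> K * hnorm (transport_space H f) x" for a
      using rep_bounded[of a] by (auto simp: transport_simps rep_closed)
  qed (auto simp: transport_simps rep_closed rep_add rep_scale rep_plus rep_scaleC rep_mult rep_star
       add_closed scale_closed)
  moreover have "M = {hzero (transport_space H f)} \<or> M = hcarrier (transport_space H f)"
    if M: "closed_hsubspace (transport_space H f) M" "\<forall>a. \<forall>x\<in>M. transport_rep H f \<pi> a x \<in> M" for M
  proof -
    obtain N where N: "closed_hsubspace H N" "M = f ` N"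
      using M(1) by (rule transport_closed_hsubspace)
    then have sub: "N \<subseteq> hcarrier H"
      using closedin_subset by (fastforce simp: closed_hsubspace_def)
    have "\<pi> a x \<in> N" if "x \<in> N" for a x
    proof -
      have x: "x \<in> hcarrier H" using sub that by blast
      have "f (\<pi> a x) \<in> f ` N" using M(2) N(2) that transport_simps(7)[OF x, of \<pi> a] by (metis imageI)
      then show ?thesis using inj sub x rep_closed by (meson inj_on_image_mem_iff)
    qed
    then have "N = {hzero H} \<or> N = hcarrier H" using irr N by (auto simp: irreducible_rep_def)
    then show ?thesis using N by (auto simp: transport_simps)
  qed
  ultimately show "irreducible_rep (transport_space H f) (transport_rep H f \<pi>)"
    by (simp add: irreducible_rep_def)
  show "rep_kernel (transport_space H f) (transport_rep H f \<pi>) = rep_kernel H \<pi>"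
    using inj by (auto simp: rep_kernel_def transport_simps inj_on_eq_iff rep_closed zero_closed)
qed

end

text \<open>The choice of carriers in \<open>Prim\<close> is harmless: any Hilbert space, over any type, may be used.\<close>

lemma rep_kernel_in_Prim:
  fixes H :: "'h hspace" and \<pi> :: "'a::cstar_algebra \<Rightarrow> 'h \<Rightarrow> 'h"
  assumes irr: "irreducible_rep H \<pi>" and nz: "rep_kernel H \<pi> \<noteq> UNIV"
  shows "rep_kernel H \<pi> \<in> Prim"
proof -
  interpret star_rep H \<pi> using irr by (simp add: irreducible_rep_def)
  obtain e a0 where e: "e \<in> hcarrier H" "\<pi> a0 e \<noteq> hzero H" using nz by (auto simp: rep_kernel_def)
  define N where "N = {x \<in> hcarrier H. \<forall>a. hinner H x (\<pi> a e) = 0}"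
  have "closed_hsubspace H N"
  proof (rule closed_hsubspaceI)
    show "l \<in> N" if "range \<sigma> \<subseteq> N" "l \<in> hcarrier H" "(\<lambda>n. hdist H (\<sigma> n) l) \<longlonglongrightarrow> 0" for \<sigma> l
      using that inner_limit[of \<sigma> l] e by (auto simp: N_def image_subset_iff rep_closed)
  qed (auto simp: N_def zero_closed add_closed scale_closed inner_add_left inner_scale_left
        inner_zero_left rep_closed e)
  moreover have "\<pi> b x \<in> N" if "x \<in> N" for b x
    using that e by (auto simp: N_def rep_closed rep_star' rep_mult[symmetric])
  ultimately have "N = {hzero H} \<or> N = hcarrier H"
    using irr by (auto simp: irreducible_rep_def)
  moreover have "\<pi> a0 e \<notin> N"
    using e inner_definite[of "\<pi> a0 e"] by (auto simp: N_def rep_closed)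
  ultimately have N: "N = {hzero H}" using e rep_closed by blast
  define f where "f = (\<lambda>x a. hinner H x (\<pi> a e))"
  have "inj_on f (hcarrier H)"
  proof (rule inj_onI)
    fix x y assume x: "x \<in> hcarrier H" and y: "y \<in> hcarrier H" and eq: "f x = f y"
    have "hdiff x y \<in> N"
      using x y e fun_cong[OF eq]
      by (auto simp: N_def f_def hdiff_closed inner_add_left inner_scale_left scale_closed rep_closed)
    then show "x = y" using N eq_if_diff_zero x y by blast
  qed
  from transport_irreducible[OF this hilbert_space_axioms irr] nz show ?thesis
    unfolding Prim_def by (smt (verit) mem_Collect_eq)
qed

end

theory Submission
  imports Defs "HOL-Computational_Algebra.Fundamental_Theorem_Algebra"
begin

text \<open>
  Why the two topologies agree. In an AF algebra an ideal is determined by the projections that it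
  contains in the stages \<open>U n\<close>, and for a projection \<open>p\<close> the set \<open>W p\<close> of the primitive ideals that do not
  contain \<open>p\<close> is both compact and open. An ideal contains \<open>p\<close> iff its hull misses \<open>W p\<close>, so in the
  Fell topology both \<open>p \<in> I\<close> and \<open>p \<notin> I\<close> are open conditions on \<open>I\<close>. As the projections in \<open>U n\<close> form a compact
  set and projections at distance less than 1 lie in the same ideals, finitely many of these conditions
  fix \<open>I \<inter> U n\<close>, that is, they cut out a ball of the metric (\<open>metric_open_imp_fell_open\<close>). Conversely, the
  compactness of \<open>K\<close> in a Fell basic set reduces the condition of missing \<open>K\<close> to a single stage, and
  the condition of meeting an open set is witnessed in a single stage (\<open>fell_open_imp_metric_open\<close>).

  Three facts about ideals carry this.

  \<^item> A projection at distance less than 1 from an ideal belongs to it (\<open>projection_near_ideal\<close>).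

  \<^item> An ideal \<open>I\<close> is the closure of the union of the \<open>I \<inter> U n\<close> (\<open>ideal_approximation\<close>), and \<open>I \<inter> U n\<close> has a
    right unit that is a projection (\<open>ideal_has_right_unit\<close>).

  \<^item> A projection outside an ideal is outside some primitive ideal above it
    (\<open>primitive_ideal_separation\<close>).

  For the second fact, all that is needed of the spectral theorem is that \<open>z\<^sup>* z\<close> has a top spectral projection,
  obtained as a limit of powers (\<open>top_projection\<close>). For the third, one descends from the given projection through
  minimal projections \<open>e n\<close> of successive stages, all outside the ideal. Compressing by \<open>e n\<close> makes
  every element asymptotically scalar, the scalar is a state, and the asymptotic formula shows directly that the
  state is positive, that the associated pre-Hilbert space is already complete, and that its
  representation is irreducible.
\<close>

section \<open>Projections and ideals\<close>

lemma star_zero [simp]: "star (0 :: 'a::cstar_algebra) = 0"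
  using star_diff[of "0::'a" 0] by simp

lemma bounded_linear_star: "bounded_linear (star :: 'a \<Rightarrow> 'a::cstar_algebra)"
  by (rule bounded_linear_intro[of _ 1]) (simp_all add: star_add star_scaleR norm_star)

lemmas tendsto_star = bounded_linear.tendsto[OF bounded_linear_star]
lemmas continuous_on_star = bounded_linear.continuous_on[OF bounded_linear_star]

lemma bounded_linear_scaleC_left: "bounded_linear (\<lambda>c. c *\<^sub>C (x :: 'a::cstar_algebra))"
proof (rule bounded_linear_intro[of _ "norm x"])
  show "(r *\<^sub>R c) *\<^sub>C x = r *\<^sub>R c *\<^sub>C x" for r c
    by (simp add: scaleR_conv_of_real scaleC_of_real[symmetric] scaleC_scaleC)
qed (simp_all add: scaleC_add_left norm_scaleC)

lemma bounded_linear_scaleC_right: "bounded_linear (\<lambda>x :: 'a::cstar_algebra. c *\<^sub>C x)"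
proof (rule bounded_linear_intro[of _ "cmod c"])
  show "c *\<^sub>C r *\<^sub>R x = r *\<^sub>R c *\<^sub>C x" for r and x :: 'a
    by (simp add: scaleC_of_real[symmetric] scaleC_scaleC mult.commute)
qed (simp_all add: scaleC_add_right norm_scaleC mult.commute)

lemmas tendsto_scaleC_right = bounded_linear.tendsto[OF bounded_linear_scaleC_right]

lemmas scaleC_minus_left = linear_neg[OF bounded_linear.linear[OF bounded_linear_scaleC_left]]
lemmas scaleC_diff_left = linear_diff[OF bounded_linear.linear[OF bounded_linear_scaleC_left]]
lemmas scaleC_diff_right = linear_diff[OF bounded_linear.linear[OF bounded_linear_scaleC_right]]

lemma scaleC_zero_left [simp]: "0 *\<^sub>C (x :: 'a::cstar_algebra) = 0"
  using norm_scaleC[of 0 x] by simp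

lemma scaleC_zero_right [simp]: "c *\<^sub>C (0 :: 'a::cstar_algebra) = 0"
  using norm_scaleC[of c "0::'a"] by simp

lemma scaleC_eq_0_iff: "c *\<^sub>C (x :: 'a::cstar_algebra) = 0 \<longleftrightarrow> c = 0 \<or> x = 0"
  using norm_scaleC[of c x] by (metis mult_eq_0_iff norm_eq_zero)

lemma star_mult_eq_0_iff: "star x * x = 0 \<longleftrightarrow> (x :: 'a::cstar_algebra) = 0"
  using norm_star_mult[of x] by (metis norm_eq_zero power_eq_0_iff mult_zero_right)

definition projections :: "'a::cstar_algebra set \<Rightarrow> 'a set" where
  "projections B = {p \<in> B. star p = p \<and> p * p = p}"

lemma projectionsD:
  "p \<in> projections B \<Longrightarrow> p \<in> B" "p \<in> projections B \<Longrightarrow> star p = p" "p \<in> projections B \<Longrightarrow> p * p = p"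
  by (simp_all add: projections_def)

lemma projections_mono: "B \<subseteq> C \<Longrightarrow> projections B \<subseteq> projections C"
  by (auto simp: projections_def)

lemma norm_projection:
  assumes "p \<in> projections B" "p \<noteq> 0"
  shows "norm p = 1"
proof -
  have "(norm p)\<^sup>2 = norm p" using norm_star_mult[of p] projectionsD[OF assms(1)] by simp
  then show ?thesis using assms(2) by (simp add: power2_eq_square)
qed

lemma norm_projection_le: "p \<in> projections B \<Longrightarrow> norm p \<le> 1"
  using norm_projection[of p B] by (cases "p = 0") auto

lemma norm_mult3: "norm (x * y * z) \<le> norm x * norm y * norm (z :: 'a::real_normed_algebra)"
  by (meson mult_right_mono norm_ge_zero norm_mult_ineq order_trans)

lemma norm_projection_compress:
  assumes "p \<in> projections B"
  shows "norm (p * x * p) \<le> norm x"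
proof -
  have "norm (p * x * p) \<le> norm p * norm x * norm p" by (rule norm_mult3)
  also have "\<dots> \<le> 1 * norm x * 1"
    using norm_projection_le[OF assms] by (intro mult_mono) auto
  finally show ?thesis by simp
qed

lemma csubspace_closed_under:
  assumes "csubspace V"
  shows "0 \<in> V" "x \<in> V \<Longrightarrow> y \<in> V \<Longrightarrow> x + y \<in> V" "x \<in> V \<Longrightarrow> y \<in> V \<Longrightarrow> x - y \<in> V"
    "x \<in> V \<Longrightarrow> c *\<^sub>C x \<in> V" "x \<in> V \<Longrightarrow> r *\<^sub>R x \<in> V"
  using complex_vector.subspace_0[OF assms] complex_vector.subspace_add[OF assms]
    complex_vector.subspace_diff[OF assms] complex_vector.subspace_scale[OF assms]
  by (simp_all flip: scaleC_of_real)

lemma ideal_closed_under: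
  assumes "I \<in> ideals"
  shows "csubspace I" "x \<in> I \<Longrightarrow> a * x \<in> I" "x \<in> I \<Longrightarrow> x * a \<in> I" "closed I"
  using assms by (simp_all add: ideals_def)

lemmas ideal_vector = csubspace_closed_under[OF ideal_closed_under(1)]

lemma subalgebra_closed_under:
  assumes "cstar_subalgebra B"
  shows "csubspace B" "x \<in> B \<Longrightarrow> y \<in> B \<Longrightarrow> x * y \<in> B" "x \<in> B \<Longrightarrow> star x \<in> B" "closed B"
  using assms by (simp_all add: cstar_subalgebra_def)

lemmas subalgebra_vector = csubspace_closed_under[OF subalgebra_closed_under(1)]

text \<open>
  Modulo \<open>I\<close> the projection \<open>p\<close> equals \<open>t = p - p y p = p (p - y) p\<close>, hence also every power of \<open>t\<close>.
  These powers tend to 0 because \<open>t\<close> has norm less than 1, so \<open>p\<close> is a limit of elements of \<open>I\<close>.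
  The resulting dichotomy (a projection lies in \<open>I\<close> or has distance at least 1 from it) stands in
  for the theory of quotient C*-algebras.
\<close>

lemma projection_near_ideal:
  assumes I: "I \<in> ideals" and p: "p \<in> projections B" and y: "y \<in> I" and near: "norm (p - y) < 1"
  shows "p \<in> I"
proof -
  note pD = projectionsD[OF p]
  define t where "t = p - p * y * p"
  have "t = p * (p - y) * p" by (simp add: t_def algebra_simps pD)
  then have nt: "norm t < 1" using norm_projection_compress[OF p, of "p - y"] near by simp
  have tp: "t * p = t" by (simp add: t_def algebra_simps pD)
  have ptI: "p - t \<in> I" using y by (simp add: t_def ideal_closed_under[OF I] ideal_vector[OF I])
  define s where "s n = ((*) t ^^ n) t" for n
  have sI: "p - s n \<in> I" for n
  proof (induction n)
    case (Suc n)
    have "p - s (Suc n) = (p - t) + t * (p - s n)" using tp by (simp add: s_def algebra_simps)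
    then show ?case by (simp only: ideal_vector(2)[OF I ptI ideal_closed_under(2)[OF I Suc]])
  qed (simp add: s_def ptI)
  have sn: "norm (s n) \<le> norm t ^ Suc n" for n
  proof (induction n)
    case (Suc n)
    have "norm (s (Suc n)) \<le> norm t * norm (s n)" by (simp add: s_def norm_mult_ineq)
    also have "\<dots> \<le> norm t * norm t ^ Suc n" using Suc by (intro mult_left_mono) auto
    finally show ?case by simp
  qed (simp add: s_def)
  have "(\<lambda>n. norm t ^ Suc n) \<longlonglongrightarrow> 0"
    using nt by (intro LIMSEQ_Suc LIMSEQ_power_zero) simp
  then have "s \<longlonglongrightarrow> 0" using sn by (intro Lim_null_comparison[of s]) auto
  then have "(\<lambda>n. p - s n) \<longlonglongrightarrow> p - 0" by (intro tendsto_intros)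
  then show ?thesis using closed_sequentially[OF ideal_closed_under(4)[OF I], of "\<lambda>n. p - s n"] sI by simp
qed

definition generated_ideal :: "'a::cstar_algebra set \<Rightarrow> 'a set" where
  "generated_ideal X = \<Inter>{J \<in> ideals. X \<subseteq> J}"

lemma generated_ideal_in_ideals: "generated_ideal X \<in> ideals"
  unfolding generated_ideal_def by (rule Inter_ideals) auto

lemma generated_ideal_subset_iff: "J \<in> ideals \<Longrightarrow> generated_ideal X \<subseteq> J \<longleftrightarrow> X \<subseteq> J"
  by (auto simp: generated_ideal_def)

lemma generated_ideal_superset: "X \<subseteq> generated_ideal X"
  by (auto simp: generated_ideal_def)

lemma generated_ideal_mono: "X \<subseteq> Y \<Longrightarrow> generated_ideal X \<subseteq> generated_ideal Y"
  by (auto simp: generated_ideal_def)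

lemma prim_hull_generated: "prim_hull (generated_ideal X) = prim_hull X"
proof -
  have "generated_ideal X \<subseteq> J \<longleftrightarrow> X \<subseteq> J" if "J \<in> Prim" for J
    using that Prim_subset_ideals by (intro generated_ideal_subset_iff) blast
  then show ?thesis by (auto simp: prim_hull_def)
qed

section \<open>Compactness in finite-dimensional subspaces\<close>

text \<open>
  Adding one vector \<open>b\<close> to a span \<open>W\<close> that does not contain it: as \<open>W\<close> is closed, \<open>b\<close> has positive
  distance from \<open>W\<close>, and this bounds the coefficient of \<open>b\<close> in every element of norm at most \<open>r\<close>. The ball is
  therefore a closed part of a continuous image of a product of two compact sets.
\<close>

lemma compact_cspan_cball:
  fixes S :: "'a::cstar_algebra set"
  assumes "finite S"
  shows "compact (cspan S \<inter> cball 0 r)"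
  using assms
proof (induction S arbitrary: r)
  case empty
  then show ?case by (auto simp: complex_vector.span_empty)
next
  case (insert b S)
  let ?W = "cspan S"
  show ?case
  proof (cases "b \<in> ?W")
    case True
    then show ?thesis using insert.IH by (simp add: complex_vector.span_redundant)
  next
    case False
    \<comment> \<open>Bounded parts of W are compact by induction, and a convergent sequence is bounded.\<close>
    have "closed ?W"
      unfolding closed_sequential_limits
    proof (intro allI impI)
      fix x l assume x: "(\<forall>n. x n \<in> ?W) \<and> x \<longlonglongrightarrow> l"
      then obtain K where K: "norm (x n) \<le> K" for n
        using convergent_imp_Bseq[of x] by (auto simp: convergent_def Bseq_def)
      have "closed (?W \<inter> cball 0 K)" using insert.IH by (rule compact_imp_closed)
      then have "l \<in> ?W \<inter> cball 0 K" using x K closed_sequentially by (metis (no_types, lifting) IntI mem_cball_0)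
      then show "l \<in> ?W" by blast
    qed
    moreover have W0: "0 \<in> ?W" by (rule complex_vector.span_zero)
    ultimately have d: "infdist b ?W > 0"
      using False in_closed_iff_infdist_zero[of ?W b] infdist_nonneg[of b ?W] by fastforce
    have bound: "cmod c * infdist b ?W \<le> norm (v + c *\<^sub>C b)" if v: "v \<in> ?W" for c v
    proof (cases "c = 0")
      case False
      have "- (inverse c *\<^sub>C v) \<in> ?W"
        using v by (intro complex_vector.span_neg complex_vector.span_scale)
      then have "infdist b ?W \<le> norm (b + inverse c *\<^sub>C v)"
        using infdist_le[of _ ?W b] by (fastforce simp: dist_norm)
      then have "cmod c * infdist b ?W \<le> norm (c *\<^sub>C (b + inverse c *\<^sub>C v))"
        by (simp add: norm_scaleC mult_left_mono)
      then show ?thesis using False by (simp add: scaleC_add_right scaleC_scaleC scaleC_one add.commute)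
    qed simp
    define R where "R = r / infdist b ?W"
    define K where "K = (\<lambda>(c, v). v + c *\<^sub>C b) ` (cball 0 R \<times> (?W \<inter> cball 0 (r + R * norm b)))"
    have "compact K"
      unfolding K_def case_prod_beta
      by (intro compact_continuous_image compact_Times compact_cball insert.IH continuous_intros
          bounded_linear.continuous_on[OF bounded_linear_scaleC_left])
    moreover have "cspan (insert b S) \<inter> cball 0 r = K \<inter> cball 0 r"
    proof (intro equalityI subsetI)
      fix x assume x: "x \<in> cspan (insert b S) \<inter> cball 0 r"
      then obtain c where c: "x - c *\<^sub>C b \<in> ?W" using complex_vector.span_breakdown_eq by blast
      have "cmod c \<le> R"
        using bound[OF c, of c] x d by (simp add: R_def pos_le_divide_eq)
      moreover have "norm (x - c *\<^sub>C b) \<le> r + R * norm b"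
        using norm_triangle_ineq4[of x "c *\<^sub>C b"] x mult_right_mono[OF \<open>cmod c \<le> R\<close>, of "norm b"]
        by (simp add: norm_scaleC)
      ultimately show "x \<in> K \<inter> cball 0 r"
        using x c unfolding K_def by (auto intro!: image_eqI[of _ _ "(c, x - c *\<^sub>C b)"])
    next
      fix x assume "x \<in> K \<inter> cball 0 r"
      then show "x \<in> cspan (insert b S) \<inter> cball 0 r"
        unfolding K_def using complex_vector.span_mono[of S "insert b S"]
        by (auto intro!: complex_vector.span_add complex_vector.span_scale complex_vector.span_base[of b "insert b S"])
    qed
    ultimately show ?thesis by (simp add: compact_Int_closed)
  qed
qed

lemma compact_finite_dim_cball:
  "finite_dim V \<Longrightarrow> compact (V \<inter> cball 0 r)"
  using compact_cspan_cball by (auto simp: finite_dim_def)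

section \<open>Projections in finite-dimensional C*-algebras\<close>

text \<open>
  The bounded sequence \<open>h, h\<^sup>2, h\<^sup>3, \<dots>\<close> has cluster points, since a finite-dimensional ball is compact,
  and the cluster points of the powers of one element form a compact abelian group under
  multiplication; \<open>e\<close> is its neutral element. (In terms of the spectrum, \<open>e\<close> is the spectral
  projection of \<open>h\<close> for the eigenvalues of modulus 1.) It is non-zero because the C*-identity keeps
  the norms of all powers of a self-adjoint element of norm 1 at 1. That \<open>h\<close> has the inverse
  \<open>g\<close> of norm at most 1 relative to \<open>e\<close> replaces the statement that \<open>h\<close> is the identity on the
  range of \<open>e\<close>, which would need \<open>h\<close> to be positive.
\<close>

lemma limit_power_projection:
  fixes h :: "'a::cstar_algebra"
  assumes B: "cstar_subalgebra B" "finite_dim B" and h: "h \<in> B" "star h = h" "norm h = 1"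
  obtains e g where "e \<in> projections B" "e \<noteq> 0" "norm g \<le> 1" "g * h = e"
proof -
  \<comment> \<open>a n is h to the power n + 1: the algebra need not have a unit.\<close>
  define a where "a n = ((*) h ^^ n) h" for n
  have a0: "a 0 = h" and aS: "a (Suc n) = h * a n" for n by (simp_all add: a_def)
  have mult: "a m * a n = a (Suc (m + n))" for m n
    by (induction m) (simp_all add: a0 aS mult.assoc)
  have aB: "a n \<in> B" for n by (induction n) (simp_all add: a0 aS h subalgebra_closed_under(2)[OF B(1)])
  have "star (a n) = a n" for n
  proof (induction n)
    case (Suc n)
    have "star (a (Suc n)) = a n * a 0" by (simp add: aS star_mult Suc h a0)
    also have "\<dots> = a (Suc n)" by (simp add: mult)
    finally show ?case .
  qed (simp add: a0 h)
  note sa = this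
  have le1: "norm (a n) \<le> 1" for n
  proof (induction n)
    case (Suc n)
    then show ?case using norm_mult_ineq[of h "a n"] h by (simp add: aS)
  qed (simp add: a0 h)
  have norm1: "norm (a n) = 1" for n
  proof -
    have sq: "norm (a (Suc (k + k))) = (norm (a k))\<^sup>2" for k
      using norm_star_mult[of "a k"] by (simp add: sa mult)
    have "\<exists>m\<ge>n. norm (a m) = 1"
    proof (induction n)
      case 0
      then show ?case using a0 h by auto
    next
      case (Suc n)
      then obtain m where "m \<ge> n" "norm (a m) = 1" by blast
      then show ?case using sq[of m] by (intro exI[of _ "Suc (m + m)"]) simp
    qed
    then obtain m where m: "m \<ge> n" "norm (a m) = 1" by blast
    show ?thesis
    proof (cases "m = n")
      case False
      then have "a m = a n * a (m - n - 1)" using m by (simp add: mult)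
      then have "1 \<le> norm (a n) * norm (a (m - n - 1))" using m norm_mult_ineq by metis
      also have "\<dots> \<le> norm (a n) * 1" using le1 by (intro mult_left_mono) auto
      finally show ?thesis using le1[of n] by simp
    qed (use m in simp)
  qed
  let ?C = "B \<inter> cball 0 1"
  have C: "seq_compact ?C" using compact_finite_dim_cball[OF B(2)] by (simp add: compact_imp_seq_compact)
  have aC: "a n \<in> ?C" for n using aB le1 by simp
  obtain l r where r: "strict_mono r" "(a \<circ> r) \<longlonglongrightarrow> l"
    using C aC unfolding seq_compact_def by meson
  \<comment> \<open>If r k and q k are the indices of two terms close to the limit l, then h to the power q k - r k
    fixes l in the limit. The choice of q makes this exponent large enough to split off another
    factor close to l, which turns the limit e into an idempotent: e l = l and e = l m.\<close>
  define q where "q k = r (2 * r k + 2)" for k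
  define p where "p k = q k - r k - 1" for k
  have q: "q k \<ge> 2 * r k + 2" for k unfolding q_def by (rule strict_mono_imp_increasing[OF r(1)])
  have pa: "a (p k) * a (r k) = a (q k)" "a (p k) = a (r k) * a (p k - r k - 1)"
    "a (p k) = a (p k - 1) * h" for k
  proof -
    have "Suc (q k - Suc (Suc (r k))) = q k - Suc (r k)" using q[of k] by simp
    then show "a (p k) * a (r k) = a (q k)" "a (p k) = a (r k) * a (p k - r k - 1)"
      "a (p k) = a (p k - 1) * h"
      using q[of k] by (simp_all add: p_def mult flip: a0)
  qed
  have "seq_compact (?C \<times> ?C \<times> ?C)"
    using compact_finite_dim_cball[OF B(2)] by (intro compact_imp_seq_compact compact_Times)
  moreover have "\<forall>k. (a (p k), a (p k - r k - 1), a (p k - 1)) \<in> ?C \<times> ?C \<times> ?C"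
    using aC by blast
  ultimately obtain w s where w: "w \<in> ?C \<times> ?C \<times> ?C" and s: "strict_mono s"
    "((\<lambda>k. (a (p k), a (p k - r k - 1), a (p k - 1))) \<circ> s) \<longlonglongrightarrow> w"
    by (rule seq_compactE)
  obtain e m g where weq: "w = (e, m, g)" by (cases w)
  have lim: "(\<lambda>k. a (p (s k))) \<longlonglongrightarrow> e" "(\<lambda>k. a (p (s k) - r (s k) - 1)) \<longlonglongrightarrow> m"
    "(\<lambda>k. a (p (s k) - 1)) \<longlonglongrightarrow> g"
    using tendsto_fst[OF s(2)] tendsto_fst[OF tendsto_snd[OF s(2)]] tendsto_snd[OF tendsto_snd[OF s(2)]]
    by (simp_all add: weq o_def)
  have rs: "(\<lambda>k. a (r (s k))) \<longlonglongrightarrow> l"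
    using LIMSEQ_subseq_LIMSEQ[OF r(2) s(1)] by (simp add: o_def)
  have "strict_mono (\<lambda>k. 2 * r (s k) + 2)"
    using r(1) s(1) by (simp add: strict_mono_def)
  then have qs: "(\<lambda>k. a (q (s k))) \<longlonglongrightarrow> l"
    using LIMSEQ_subseq_LIMSEQ[OF r(2)] by (simp add: o_def q_def)
  have "(\<lambda>k. a (p (s k)) * a (r (s k))) \<longlonglongrightarrow> e * l" by (intro tendsto_mult lim rs)
  then have el: "e * l = l" using qs unfolding pa(1) by (metis LIMSEQ_unique)
  have "(\<lambda>k. a (r (s k)) * a (p (s k) - r (s k) - 1)) \<longlonglongrightarrow> l * m" by (intro tendsto_mult lim rs)
  then have em: "e = l * m" using lim(1) unfolding pa(2)[symmetric] by (metis LIMSEQ_unique)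
  have "(\<lambda>k. a (p (s k) - 1) * h) \<longlonglongrightarrow> g * h" by (intro tendsto_intros lim)
  then have gh: "g * h = e" using lim(1) unfolding pa(3)[symmetric] by (metis LIMSEQ_unique)
  have "star e = e"
    using LIMSEQ_unique[OF tendsto_star[OF lim(1)]] lim(1) by (simp add: sa)
  moreover have "e * e = e" using el em by (metis mult.assoc)
  moreover have "norm e = 1" using LIMSEQ_unique[OF tendsto_norm[OF lim(1)]] by (simp add: norm1)
  ultimately show ?thesis
    using w gh by (intro that[of e g]) (auto simp: weq projections_def)
qed

text \<open>
  The form in which the preceding lemma is used: \<open>e\<close> is a spectral projection of \<open>z\<^sup>* z\<close> at its
  norm, and the equation shows that \<open>e\<close> lies in every left ideal that contains \<open>z\<close>.
\<close>

lemma top_projection: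
  fixes z :: "'a::cstar_algebra"
  assumes B: "cstar_subalgebra B" "finite_dim B" and z: "z \<in> B" "z \<noteq> 0"
  obtains e g where "e \<in> projections B" "e \<noteq> 0" "norm g \<le> 1" "g * (star z * z) = (norm z)\<^sup>2 *\<^sub>R e"
proof -
  define h where "h = (1 / (norm z)\<^sup>2) *\<^sub>R (star z * z)"
  have "h \<in> B" "star h = h" "norm h = 1"
    using z by (simp_all add: h_def subalgebra_closed_under[OF B(1)] subalgebra_vector[OF B(1)] star_scaleR star_mult star_star norm_star_mult)
  then obtain e g where "e \<in> projections B" "e \<noteq> 0" "norm g \<le> 1" "g * h = e"
    using limit_power_projection[OF B] by blast
  then show ?thesis using z by (intro that[of e g]) (auto simp: h_def)
qed

lemma finite_projection_net:
  fixes B :: "'a::cstar_algebra set"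
  assumes B: "cstar_subalgebra B" "finite_dim B"
  obtains E where "finite E" "E \<subseteq> projections B" "\<And>p. p \<in> projections B \<Longrightarrow> \<exists>e\<in>E. norm (p - e) < 1 / 2"
proof -
  have "projections B = (B \<inter> cball 0 1) \<inter> ({x. star x = x} \<inter> {x. x * x = x})"
    using norm_projection_le[of _ B] by (auto simp: projections_def)
  moreover have "closed ({x :: 'a. star x = x} \<inter> {x. x * x = x})"
    by (intro closed_Int closed_Collect_eq continuous_intros continuous_on_star)
  ultimately have "compact (projections B)"
    using compact_finite_dim_cball[OF B(2)] by (simp only: compact_Int_closed)
  then obtain E where E: "finite E" "E \<subseteq> projections B" "projections B \<subseteq> (\<Union>x\<in>E. ball x (1 / 2))"
    using seq_compact_imp_totally_bounded[OF compact_imp_seq_compact, of "projections B"]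
    by (meson half_gt_zero zero_less_one)
  show ?thesis
    using E by (intro that[of E]) (force simp: dist_norm norm_minus_commute)+
qed

definition strictly_below :: "'a::cstar_algebra set \<Rightarrow> ('a \<times> 'a) set" where
  "strictly_below B = {(p, q). p \<in> projections B \<and> q \<in> projections B \<and> p * q = p \<and> p \<noteq> q}"

lemma absorb_commute:
  assumes "p \<in> projections B" "q \<in> projections C" "p * q = p"
  shows "q * p = p"
  using arg_cong[OF assms(3), of star] projectionsD(2)[OF assms(1)] projectionsD(2)[OF assms(2)]
  by (simp add: star_mult)

lemma trans_strictly_below: "trans (strictly_below B)"
proof (rule transI)
  fix p q r assume pq: "(p, q) \<in> strictly_below B" and qr: "(q, r) \<in> strictly_below B"
  then have P: "p \<in> projections B" "q \<in> projections B" "r \<in> projections B" "p * q = p" "q * r = q" "p \<noteq> q"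
    by (auto simp: strictly_below_def)
  have "p * r = p" using P by (metis mult.assoc)
  moreover have "p \<noteq> r" using P absorb_commute[of p B q B] by auto
  ultimately show "(p, r) \<in> strictly_below B" using P by (simp add: strictly_below_def)
qed

lemma norm_diff_strictly_below:
  assumes "csubspace B" "(p, q) \<in> strictly_below B"
  shows "norm (p - q) = 1"
proof -
  have P: "p \<in> projections B" "q \<in> projections B" "p * q = p" "p \<noteq> q"
    using assms(2) by (auto simp: strictly_below_def)
  have "q * p = p" using absorb_commute P by blast
  then have "q - p \<in> projections B"
    using P csubspace_closed_under(3)[OF assms(1)] by (simp add: projections_def star_diff algebra_simps)
  then show ?thesis using norm_projection P(4) by (metis norm_minus_commute right_minus_eq)
qed

text \<open>
  Comparable distinct projections have distance 1, whereas two of infinitely many elements of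
  \<open>projections B\<close> must be close to the same point of a finite net.
\<close>

lemma finite_projection_chains:
  assumes B: "cstar_subalgebra B" "finite_dim B"
    and chain: "\<And>i j :: nat. i < j \<Longrightarrow> (f i, f j) \<in> strictly_below B \<or> (f j, f i) \<in> strictly_below B"
  shows False
proof -
  have sub: "csubspace B" using B by (simp add: cstar_subalgebra_def)
  obtain E where E: "finite E" "\<And>p. p \<in> projections B \<Longrightarrow> \<exists>e\<in>E. norm (p - e) < 1 / 2"
    using finite_projection_net[OF B] by metis
  have "f i \<in> projections B" for i using chain[of i "Suc i"] by (auto simp: strictly_below_def)
  then have "\<forall>i. \<exists>e\<in>E. norm (f i - e) < 1 / 2" using E by blast
  then obtain g where g: "\<And>i. g i \<in> E" "\<And>i. norm (f i - g i) < 1 / 2" by metis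
  have "finite (range g)" using g E(1) by (meson finite_subset image_subsetI)
  then have "\<not> inj g" using finite_imageD infinite_UNIV_nat by blast
  then obtain i j where "g i = g j" "i \<noteq> j" by (auto simp: inj_def)
  then obtain i j where ij: "i < j" "g i = g j" by (metis linorder_neqE_nat)
  have "norm (f i - f j) = 1" "norm (f j - f i) = 1"
    using chain[OF ij(1)] norm_diff_strictly_below[OF sub] norm_minus_commute by metis+
  moreover have "norm (f i - f j) < 1 / 2 + 1 / 2"
    using g(2)[of i] g(2)[of j] ij(2) norm_triangle_ineq4[of "f i - g i" "f j - g i"] by simp
  ultimately show False by simp
qed

lemma wf_strictly_below:
  assumes B: "cstar_subalgebra B" "finite_dim B"
  shows "wf (strictly_below B)" "wf ((strictly_below B)\<inverse>)"
proof -
  have lift: "(f i, f j) \<in> R" if "trans R" "\<forall>i. (f i, f (Suc i)) \<in> R" "i < j" for f :: "nat \<Rightarrow> 'a" and R i j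
    using that(3)
  proof (induction j)
    case (Suc j)
    then show ?case using that(1,2) by (metis less_Suc_eq transD)
  qed simp
  have "\<not> (\<forall>i. (f (Suc i), f i) \<in> strictly_below B)" for f
  proof
    assume f: "\<forall>i. (f (Suc i), f i) \<in> strictly_below B"
    have "(f j, f i) \<in> strictly_below B" if "i < j" for i j
      using lift[of "(strictly_below B)\<inverse>" f i j] trans_strictly_below[of B] f that by simp
    then show False using finite_projection_chains[OF B, of f] by blast
  qed
  moreover have "\<not> (\<forall>i. (f (Suc i), f i) \<in> (strictly_below B)\<inverse>)" for f
  proof
    assume f: "\<forall>i. (f (Suc i), f i) \<in> (strictly_below B)\<inverse>"
    have "(f i, f j) \<in> strictly_below B" if "i < j" for i j
      using lift[of "strictly_below B" f i j] trans_strictly_below[of B] f that by simp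
    then show False using finite_projection_chains[OF B, of f] by blast
  qed
  ultimately show "wf (strictly_below B)" "wf ((strictly_below B)\<inverse>)"
    by (simp_all add: wf_iff_no_infinite_down_chain)
qed

text \<open>
  A maximal projection \<open>p\<close> of \<open>J \<inter> B\<close> works: if \<open>z = x - x p\<close> were non-zero, then the top projection
  of \<open>z\<close> would lie in \<open>J\<close> and be orthogonal to \<open>p\<close>, so that adding it to \<open>p\<close> would contradict
  maximality. Consequently the inclusion of \<open>J \<inter> B\<close> in another ideal is decided by the single
  element \<open>p\<close>.
\<close>

lemma ideal_has_right_unit:
  assumes B: "cstar_subalgebra B" "finite_dim B" and J: "J \<in> ideals"
  obtains p where "p \<in> projections B" "p \<in> J" "\<And>x. x \<in> J \<inter> B \<Longrightarrow> x * p = x"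
proof -
  note Bc = subalgebra_closed_under[OF B(1)] subalgebra_vector[OF B(1)]
  note Jc = ideal_closed_under[OF J] ideal_vector[OF J]
  have "0 \<in> projections B \<inter> J" by (simp add: projections_def Bc Jc)
  then obtain p where p: "p \<in> projections B \<inter> J"
    and max: "\<And>q. (p, q) \<in> strictly_below B \<Longrightarrow> q \<notin> projections B \<inter> J"
    using wf_strictly_below(2)[OF B] unfolding wf_eq_minimal converse_iff by meson
  note pD = projectionsD[of p B]
  have "x * p = x" if x: "x \<in> J \<inter> B" for x
  proof (rule ccontr)
    assume "x * p \<noteq> x"
    define z where "z = x - x * p"
    have z: "z \<in> B" "z \<noteq> 0" "z \<in> J" using x p pD \<open>x * p \<noteq> x\<close> by (auto simp: z_def Bc Jc)
    obtain e g where e: "e \<in> projections B" "e \<noteq> 0" "g * (star z * z) = (norm z)\<^sup>2 *\<^sub>R e"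
      using top_projection[OF B z(1,2)] by metis
    note eD = projectionsD[OF e(1)]
    have e_eq: "e = (1 / (norm z)\<^sup>2) *\<^sub>R (g * (star z * z))" using e(3) z by simp
    then have "e \<in> J" using z by (simp add: Jc)
    have "z * p = 0" using p pD by (simp add: z_def algebra_simps)
    then have ep: "e * p = 0" by (simp add: e_eq mult.assoc)
    then have pe: "p * e = 0"
      using star_mult[of e p] p pD eD by simp
    have ps: "star p = p" "p * p = p" "p \<in> B" using p pD by auto
    have "(p + e) * (p + e) = p + e" by (simp add: distrib_left distrib_right ps eD(3) ep pe)
    then have "p + e \<in> projections B"
      unfolding projections_def using Bc(6)[OF ps(3) eD(1)] by (simp add: star_add ps eD(2))
    moreover have "(p, p + e) \<in> strictly_below B"
      using calculation p e(2) by (simp add: strictly_below_def distrib_left ps pe)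
    ultimately show False using max[of "p + e"] p \<open>e \<in> J\<close> by (simp add: Jc)
  qed
  then show ?thesis using p that by blast
qed

text \<open>
  Minimality among the projections outside \<open>I\<close> already gives minimality among all projections of
  \<open>B\<close>: if \<open>q \<le> e\<close>, then \<open>q\<close> and \<open>e - q\<close> cannot both lie in \<open>I\<close>, and the one outside \<open>I\<close> must be \<open>e\<close>.
\<close>

lemma minimal_projection_outside_ideal:
  assumes B: "cstar_subalgebra B" "finite_dim B" and I: "I \<in> ideals"
    and f: "f \<in> projections B" "f \<notin> I"
  obtains e where "e \<in> projections B" "e \<notin> I" "e * f = e"
    "\<And>q. q \<in> projections B \<Longrightarrow> q * e = q \<Longrightarrow> q = 0 \<or> q = e"
proof -
  let ?S = "{e \<in> projections B. e \<notin> I \<and> e * f = e}"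
  have "f \<in> ?S" using f projectionsD[OF f(1)] by simp
  then obtain e where e: "e \<in> ?S" and min: "\<And>q. (q, e) \<in> strictly_below B \<Longrightarrow> q \<notin> ?S"
    using wf_strictly_below(1)[OF B] unfolding wf_eq_minimal by meson
  have eB: "e \<in> projections B" and ef: "e * f = e" using e by auto
  note eD = projectionsD[OF eB]
  have drop: "q = e" if "q \<in> projections B" "q * e = q" "q \<notin> I" for q
    using min[of q] that ef eB mult.assoc[of q e f] by (auto simp: strictly_below_def)
  show ?thesis
  proof (rule that[of e])
    show "q = 0 \<or> q = e" if q: "q \<in> projections B" "q * e = q" for q
    proof (cases "q \<in> I")
      case True
      have eq: "e * q = q" using absorb_commute q eB by blast
      have "e - q \<notin> I" using e True ideal_vector(2)[OF I, of "e - q" q] by auto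
      moreover have "e - q \<in> projections B"
        using q eD eq projectionsD[OF q(1)] by (simp add: projections_def star_diff algebra_simps subalgebra_vector[OF B(1)])
      moreover have "(e - q) * e = e - q" using q eD by (simp add: algebra_simps)
      ultimately have "e - q = e" using drop by blast
      then show ?thesis by simp
    qed (use drop q in blast)
  qed (use e in auto)
qed

lemma polynomial_relation:
  fixes a :: "nat \<Rightarrow> 'a::cstar_algebra"
  assumes "finite_dim B" "range a \<subseteq> B"
  obtains p :: "complex poly" where "p \<noteq> 0" "(\<Sum>i\<le>degree p. coeff p i *\<^sub>C a i) = 0"
proof -
  have ex: "\<exists>p :: complex poly. p \<noteq> 0 \<and> (\<Sum>i\<le>degree p. coeff p i *\<^sub>C a i) = 0"
    if u: "finite T" "(\<Sum>i\<in>T. u i *\<^sub>C a i) = 0" "j \<in> T" "u j \<noteq> 0" for T :: "nat set" and u j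
  proof -
    define p where "p = (\<Sum>i\<in>T. monom (u i) i)"
    have c: "coeff p i = (if i \<in> T then u i else 0)" for i
      using u(1) by (simp add: p_def coeff_sum sum.delta)
    have "(\<Sum>i\<le>degree p. coeff p i *\<^sub>C a i) = (\<Sum>i\<in>T. u i *\<^sub>C a i)"
    proof (rule sum.mono_neutral_cong)
      show "u i *\<^sub>C a i = 0" if "i \<in> T - {..degree p}" for i
        using that c[of i] by (simp add: coeff_eq_0)
    qed (use u(1) in \<open>auto simp: c\<close>)
    then show ?thesis using u c[of j] by (intro exI[of _ p]) auto
  qed
  have "\<exists>T u j. finite T \<and> (\<Sum>i\<in>T. u i *\<^sub>C a i) = 0 \<and> j \<in> T \<and> u j \<noteq> 0"
  proof (cases "inj a")
    case True
    obtain S where S: "finite S" "B = cspan S" using assms(1) by (auto simp: finite_dim_def)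
    have "infinite (range a)" using True finite_imageD infinite_UNIV_nat by blast
    then have "complex_vector.dependent (range a)"
      using complex_vector.independent_span_bound[OF S(1)] assms(2) S(2) by blast
    then obtain T u v where T: "finite T" "T \<subseteq> range a" "(\<Sum>v\<in>T. u v *\<^sub>C v) = 0" "v \<in> T" "u v \<noteq> 0"
      unfolding complex_vector.dependent_explicit by blast
    obtain T' where T': "T = a ` T'" using T(2) subset_imageE by blast
    then have "finite T'" "(\<Sum>i\<in>T'. u (a i) *\<^sub>C a i) = 0"
      using T(1,3) True by (simp_all add: finite_image_iff inj_on_subset sum.reindex)
    moreover obtain j where "j \<in> T'" "v = a j" using T(4) T' by blast
    ultimately show ?thesis
      using T(5) by (intro exI[of _ T'] exI[of _ "\<lambda>i. u (a i)"] exI[of _ j]) simp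
  next
    case False
    then obtain i j where ij: "a i = a j" "i \<noteq> j" by (auto simp: inj_def)
    then show ?thesis
      by (intro exI[of _ "{i, j}"] exI[of _ "\<lambda>k. if k = i then 1 else - 1"] exI[of _ i])
         (simp add: scaleC_minus_left)
  qed
  then show ?thesis using ex that by blast
qed

text \<open>
  In the corner \<open>e B e\<close> every non-zero element \<open>w\<close> has a left inverse, because its top projection is a
  non-zero projection below \<open>e\<close> and hence equal to \<open>e\<close>. So \<open>e B e\<close> is a finite-dimensional division
  algebra over the complex numbers and therefore consists of the multiples of \<open>e\<close>: an annihilating
  polynomial of least degree of \<open>y = e x e\<close> has a root \<open>c\<close>, and \<open>y - c e\<close> is a zero divisor.
\<close>

lemma minimal_projection_compression:
  fixes e :: "'a::cstar_algebra"
  assumes B: "cstar_subalgebra B" "finite_dim B" and e: "e \<in> projections B" "e \<noteq> 0"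
    and min: "\<And>q. q \<in> projections B \<Longrightarrow> q * e = q \<Longrightarrow> q = 0 \<or> q = e" and x: "x \<in> B"
  shows "\<exists>c. e * x * e = c *\<^sub>C e"
proof -
  note Bc = subalgebra_closed_under[OF B(1)] subalgebra_vector[OF B(1)]
  note eD = projectionsD[OF e(1)]
  have left_inverse: "\<exists>u. u * w = e" if w: "w \<in> B" "w \<noteq> 0" "w * e = w" for w
  proof -
    obtain q g where q: "q \<in> projections B" "q \<noteq> 0" "g * (star w * w) = (norm w)\<^sup>2 *\<^sub>R q"
      using top_projection[OF B w(1,2)] by metis
    then have q_eq: "q = ((1 / (norm w)\<^sup>2) *\<^sub>R (g * star w)) * w"
      using w by (simp add: mult.assoc)
    then have "q * e = q" using w(3) by (metis mult.assoc)
    then show ?thesis using min q q_eq by metis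
  qed
  define y where "y = e * x * e"
  have y: "y \<in> B" "y * e = y" "e * y = y" using x eD by (simp_all add: y_def Bc mult.assoc) (metis mult.assoc eD(3))
  define a where "a n = ((*) y ^^ n) e" for n
  have aS: "a 0 = e" "a (Suc n) = y * a n" for n by (simp_all add: a_def)
  have a: "a n \<in> B" "e * a n = a n" for n
    by (induction n) (simp_all add: aS eD y Bc flip: mult.assoc)
  \<comment> \<open>a n is y to the power n with y to the power 0 read as e, and ev p is p evaluated at y.\<close>
  define ev where "ev p = (\<Sum>i\<le>degree p. coeff p i *\<^sub>C a i)" for p
  have "\<exists>p. p \<noteq> 0 \<and> ev p = 0"
    using polynomial_relation[OF B(2), of a] a(1) unfolding ev_def by (metis image_subsetI)
  then obtain p where p: "p \<noteq> 0" "ev p = 0" and pmin: "\<And>q. degree q < degree p \<Longrightarrow> \<not> (q \<noteq> 0 \<and> ev q = 0)"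
    using exists_least_iff[of "\<lambda>n. \<exists>p. p \<noteq> 0 \<and> ev p = 0 \<and> degree p = n"] by metis
  have "degree p \<noteq> 0"
  proof
    assume "degree p = 0"
    then have "coeff p 0 *\<^sub>C e = 0" "coeff p 0 \<noteq> 0" using p by (auto simp: ev_def aS leading_coeff_0_iff[symmetric] simp del: leading_coeff_0_iff)
    then show False using e(2) by (simp add: scaleC_eq_0_iff)
  qed
  then obtain c where "poly p c = 0"
    using fundamental_theorem_of_algebra[of p] constant_degree[of p] by auto
  then obtain q where q: "p = [:- c, 1:] * q" by (metis dvdE poly_eq_0_iff_dvd)
  have q0: "q \<noteq> 0" using p(1) q by auto
  then have deg: "degree p = Suc (degree q)" unfolding q by (subst degree_mult_eq) auto
  then have evq: "ev q \<noteq> 0" using pmin[of q] q0 by simp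
  have "coeff p i *\<^sub>C a i = (case i of 0 \<Rightarrow> 0 | Suc j \<Rightarrow> coeff q j) *\<^sub>C a i - c *\<^sub>C coeff q i *\<^sub>C a i" for i
    by (simp add: q coeff_pCons scaleC_diff_left[symmetric] scaleC_scaleC scaleC_minus_left split: nat.split)
  then have "ev p = (\<Sum>i\<le>Suc (degree q). (case i of 0 \<Rightarrow> 0 | Suc j \<Rightarrow> coeff q j) *\<^sub>C a i)
      - (\<Sum>i\<le>Suc (degree q). c *\<^sub>C coeff q i *\<^sub>C a i)"
    by (simp only: ev_def deg sum_subtractf)
  (* The two sums are the values at y of X * q and of c * q. *)
  also have "(\<Sum>i\<le>Suc (degree q). (case i of 0 \<Rightarrow> 0 | Suc j \<Rightarrow> coeff q j) *\<^sub>C a i) = y * ev q"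
    by (simp add: sum.atMost_Suc_shift aS ev_def sum_distrib_left mult_scaleC_right del: sum.atMost_Suc)
  also have "(\<Sum>i\<le>Suc (degree q). c *\<^sub>C coeff q i *\<^sub>C a i) = (c *\<^sub>C e) * ev q"
    by (simp add: coeff_eq_0 ev_def sum_distrib_left mult_scaleC_left mult_scaleC_right a scaleC_scaleC mult.commute)
  finally have "(y - c *\<^sub>C e) * ev q = 0" using p(2) by (simp add: algebra_simps)
  moreover have "ev q = e * ev q" by (simp add: ev_def sum_distrib_left mult_scaleC_right a)
  moreover have "(y - c *\<^sub>C e) * e = y - c *\<^sub>C e" "y - c *\<^sub>C e \<in> B"
    using y eD by (simp_all add: algebra_simps mult_scaleC_left Bc)
  ultimately have "y - c *\<^sub>C e = 0"
    using left_inverse[of "y - c *\<^sub>C e"] evq by (metis mult.assoc mult_zero_right)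
  then show ?thesis by (auto simp: y_def)
qed

section \<open>The state excised by a decreasing sequence of minimal projections\<close>

text \<open>
  The compressions of a fixed \<open>x\<close> by a decreasing sequence of minimal projections \<open>e n\<close> become
  asymptotically scalar, and the scalar is the value at \<open>x\<close> of a pure state \<open>\<phi>\<close>. The
  asymptotic formula for \<open>\<phi>\<close> replaces the convexity arguments by which pure states are usually
  obtained and by which their representations are usually seen to be irreducible.
\<close>

locale excising_sequence =
  fixes V :: "nat \<Rightarrow> 'a::cstar_algebra set" and e :: "nat \<Rightarrow> 'a"
  assumes subalgebra: "cstar_subalgebra (V n)" and increasing: "incseq V"
    and dense: "closure (\<Union>n. V n) = UNIV"
    and projection: "e n \<in> projections (V n)" and nonzero: "e n \<noteq> 0"
    and decreasing: "e (Suc n) * e n = e (Suc n)"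
    and compression: "x \<in> V n \<Longrightarrow> \<exists>c. e n * x * e n = c *\<^sub>C e n"
begin

lemmas e_star [simp] = projectionsD(2)[OF projection]
lemmas e_idem [simp] = projectionsD(3)[OF projection]

lemma norm_e [simp]: "norm (e n) = 1"
  using norm_projection[OF projection nonzero] .

lemma e_absorb:
  assumes "m \<le> n"
  shows "e n * e m = e n" "e m * e n = e n"
proof -
  show 1: "e n * e m = e n"
    using assms
  proof (induction n rule: dec_induct)
    case (step n)
    then show ?case using decreasing[of n] by (metis mult.assoc)
  qed simp
  show "e m * e n = e n"
    using absorb_commute[OF projection projection 1] .
qed

lemma approximation:
  obtains y N where "\<And>k. y k \<in> V (N k)" "y \<longlonglongrightarrow> x"
proof -
  have "x \<in> closure (\<Union>n. V n)" using dense by simp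
  then obtain y where y: "\<And>k. y k \<in> (\<Union>n. V n)" "y \<longlonglongrightarrow> x" by (auto simp: closure_sequential)
  then have "\<forall>k. \<exists>n. y k \<in> V n" by blast
  then show ?thesis using y that by metis
qed

lemma compression_eventually:
  assumes "x \<in> V m"
  shows "\<exists>c. \<forall>n\<ge>m. e n * x * e n = c *\<^sub>C e n"
proof -
  obtain c where c: "e m * x * e m = c *\<^sub>C e m" using compression assms by blast
  have "e n * x * e n = c *\<^sub>C e n" if "n \<ge> m" for n
  proof -
    have "e n * x * e n = (e n * e m) * x * (e m * e n)" using e_absorb[OF that] by simp
    also have "\<dots> = e n * (e m * x * e m) * e n" by (simp add: mult.assoc)
    also have "\<dots> = c *\<^sub>C e n" using e_absorb[OF that] by (simp add: c mult_scaleC_left mult_scaleC_right)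
    finally show ?thesis .
  qed
  then show ?thesis by blast
qed

definition excised :: "'a \<Rightarrow> complex \<Rightarrow> bool" where
  "excised x c \<longleftrightarrow> (\<lambda>n. e n * x * e n - c *\<^sub>C e n) \<longlonglongrightarrow> 0"

lemma excised_unique:
  assumes "excised x c" "excised x d"
  shows "c = d"
proof -
  have "(\<lambda>n. (e n * x * e n - c *\<^sub>C e n) - (e n * x * e n - d *\<^sub>C e n)) \<longlonglongrightarrow> 0 - 0"
    using assms unfolding excised_def by (intro tendsto_diff)
  then have "(\<lambda>n. norm ((d - c) *\<^sub>C e n)) \<longlonglongrightarrow> 0"
    by (intro tendsto_norm_zero) (simp add: scaleC_diff_left)
  then show ?thesis by (simp add: norm_scaleC LIMSEQ_const_iff)
qed

lemma excised_exists: "\<exists>c. excised x c"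
proof -
  obtain y N where y: "\<And>k. y k \<in> V (N k)" "y \<longlonglongrightarrow> x" by (rule approximation[of x], blast)
  have "\<forall>k. \<exists>c. \<forall>n\<ge>N k. e n * y k * e n = c *\<^sub>C e n" using compression_eventually y(1) by blast
  then obtain c where c: "\<And>k n. n \<ge> N k \<Longrightarrow> e n * y k * e n = c k *\<^sub>C e n" by metis
  have cdist: "dist (c k) (c l) \<le> dist (y k) (y l)" for k l
  proof -
    define n where "n = max (N k) (N l)"
    have "e n * (y k - y l) * e n = (c k - c l) *\<^sub>C e n"
      unfolding left_diff_distrib right_diff_distrib scaleC_diff_left by (simp add: c n_def)
    then have "cmod (c k - c l) = norm (e n * (y k - y l) * e n)" by (simp add: norm_scaleC)
    also have "\<dots> \<le> norm (y k - y l)" by (rule norm_projection_compress[OF projection])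
    finally show ?thesis by (simp add: dist_norm)
  qed
  have "Cauchy y" using y(2) by (rule LIMSEQ_imp_Cauchy)
  then have "Cauchy c" unfolding Cauchy_def using cdist by (meson le_less_trans)
  then obtain d where d: "c \<longlonglongrightarrow> d" using Cauchy_convergent convergent_def by blast
  have "excised x d"
    unfolding excised_def
  proof (rule LIMSEQ_I)
    \<comment> \<open>Compare x with a single y k, for which the compression is exactly scalar from N k on.\<close>
    fix r :: real assume "r > 0"
    then have "\<forall>\<^sub>F k in sequentially. dist (y k) x < r / 2 \<and> dist (c k) d < r / 2"
      by (intro eventually_conj tendstoD[OF y(2)] tendstoD[OF d]) auto
    then obtain k where k: "dist (y k) x < r / 2" "dist (c k) d < r / 2"
      using eventually_happens'[OF sequentially_bot] by blast
    have "norm (e n * x * e n - d *\<^sub>C e n - 0) < r" if "n \<ge> N k" for n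
    proof -
      have "e n * x * e n - d *\<^sub>C e n = e n * (x - y k) * e n + (c k - d) *\<^sub>C e n"
        using c[OF that] by (simp add: algebra_simps scaleC_diff_left)
      also have "norm \<dots> \<le> norm (x - y k) + cmod (c k - d)"
        by (intro norm_triangle_mono norm_projection_compress[OF projection]) (simp add: norm_scaleC)
      finally show ?thesis using k by (simp add: dist_norm norm_minus_commute)
    qed
    then show "\<exists>M. \<forall>n\<ge>M. norm (e n * x * e n - d *\<^sub>C e n - 0) < r" by blast
  qed
  then show ?thesis by blast
qed

definition \<phi> :: "'a \<Rightarrow> complex" where
  "\<phi> x = (THE c. excised x c)"

lemma excised_\<phi>: "excised x (\<phi> x)"
  unfolding \<phi>_def using excised_exists excised_unique by (metis the_equality)

lemma \<phi>_eqI: "excised x c \<Longrightarrow> \<phi> x = c"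
  using excised_unique excised_\<phi> by blast

lemma \<phi>_excises: "(\<lambda>n. e n * x * e n - \<phi> x *\<^sub>C e n) \<longlonglongrightarrow> 0"
  using excised_\<phi> by (simp add: excised_def)

lemma \<phi>_add: "\<phi> (x + y) = \<phi> x + \<phi> y"
  using tendsto_add[OF \<phi>_excises[of x] \<phi>_excises[of y]]
  by (intro \<phi>_eqI) (simp add: excised_def algebra_simps scaleC_add_left)

lemma \<phi>_scaleC: "\<phi> (c *\<^sub>C x) = c * \<phi> x"
  using tendsto_scaleC_right[OF \<phi>_excises[of x], of c]
  by (intro \<phi>_eqI) (simp add: excised_def scaleC_diff_right mult_scaleC_left mult_scaleC_right scaleC_scaleC)

lemma \<phi>_star: "\<phi> (star x) = cnj (\<phi> x)"
  using tendsto_star[OF \<phi>_excises[of x]]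
  by (intro \<phi>_eqI) (simp add: excised_def star_diff star_mult star_scaleC mult.assoc)

lemma \<phi>_zero [simp]: "\<phi> 0 = 0"
  using \<phi>_scaleC[of 0 0] by simp

lemma \<phi>_diff: "\<phi> (x - y) = \<phi> x - \<phi> y"
  using \<phi>_add[of "x - y" y] by simp

lemma \<phi>_absorb: "\<phi> (x * e m) = \<phi> x" "\<phi> (e m * x) = \<phi> x"
proof -
  have "\<forall>\<^sub>F n in sequentially. e n * x * e n - \<phi> x *\<^sub>C e n = e n * (x * e m) * e n - \<phi> x *\<^sub>C e n"
    "\<forall>\<^sub>F n in sequentially. e n * x * e n - \<phi> x *\<^sub>C e n = e n * (e m * x) * e n - \<phi> x *\<^sub>C e n"
    using e_absorb by (auto simp: eventually_sequentially mult.assoc intro!: exI[of _ m]) (metis mult.assoc)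
  then show "\<phi> (x * e m) = \<phi> x" "\<phi> (e m * x) = \<phi> x"
    using Lim_transform_eventually[OF \<phi>_excises[of x]] by (auto intro!: \<phi>_eqI simp: excised_def)
qed

lemma \<phi>_e [simp]: "\<phi> (e n) = 1"
proof -
  have "\<forall>\<^sub>F m in sequentially. 0 = e m * e n * e m - 1 *\<^sub>C e m"
    using e_absorb by (auto simp: eventually_sequentially scaleC_one intro!: exI[of _ n])
  then show ?thesis
    by (intro \<phi>_eqI) (auto simp: excised_def intro: Lim_transform_eventually[OF tendsto_const])
qed

lemma norm_compression_tendsto: "(\<lambda>n. norm (e n * x * e n)) \<longlonglongrightarrow> cmod (\<phi> x)"
proof (rule LIM_zero_cancel, rule Lim_null_comparison)
  show "\<forall>\<^sub>F n in sequentially. norm (norm (e n * x * e n) - cmod (\<phi> x)) \<le> norm (e n * x * e n - \<phi> x *\<^sub>C e n)"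
    using norm_triangle_ineq3[of "e n * x * e n" "\<phi> x *\<^sub>C e n" for n]
    by (auto simp: norm_scaleC)
  show "(\<lambda>n. norm (e n * x * e n - \<phi> x *\<^sub>C e n)) \<longlonglongrightarrow> 0"
    using tendsto_norm_zero[OF \<phi>_excises] .
qed

lemma norm_\<phi>_le: "cmod (\<phi> x) \<le> norm x"
  using norm_projection_compress[OF projection]
  by (intro LIMSEQ_le_const2[OF norm_compression_tendsto]) blast

lemma bounded_linear_\<phi>: "bounded_linear \<phi>"
  by (rule bounded_linear_intro[of _ 1])
     (simp_all add: \<phi>_add norm_\<phi>_le \<phi>_scaleC scaleR_conv_of_real flip: scaleC_of_real)

text \<open>
  For \<open>y = x e\<^sub>m\<close> the element \<open>y\<^sup>* y\<close> is a real multiple \<open>t e\<^sub>m\<close>. A negative \<open>t\<close> is excluded without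
  any spectral theory: \<open>z = \<alpha> e\<^sub>m + y\<close> also has \<open>z\<^sup>* z\<close> a multiple of \<open>e\<^sub>m\<close>, and if \<open>t < 0\<close>, then \<open>\<alpha>\<close>
  can be chosen so that the multiple is 0. Then \<open>z = 0\<close>, so \<open>y\<close> itself is a multiple of \<open>e\<^sub>m\<close>
  and \<open>t\<close> is a squared modulus.
\<close>

lemma \<phi>_positive_dense:
  assumes x: "x \<in> V m"
  shows "\<phi> (star x * x) = of_real (cmod (\<phi> (star x * x)))"
proof -
  define y where "y = x * e m"
  obtain \<beta> where \<beta>: "e m * y = \<beta> *\<^sub>C e m"
    using compression[OF x] by (auto simp: y_def mult.assoc)
  have \<beta>': "star y * e m = cnj \<beta> *\<^sub>C e m"
    using arg_cong[OF \<beta>, of star] by (simp add: star_mult star_scaleC)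
  have "star x * x \<in> V m" using x subalgebra_closed_under[OF subalgebra] by blast
  then obtain c where "e m * (star x * x) * e m = c *\<^sub>C e m" using compression by blast
  then have c: "star y * y = c *\<^sub>C e m" by (simp add: y_def star_mult mult.assoc)
  have "star y * y = e m * ((star x * x) * e m)" by (simp add: y_def star_mult mult.assoc)
  then have "\<phi> (star x * x) = \<phi> (star y * y)" by (simp only: \<phi>_absorb)
  then have phi: "\<phi> (star x * x) = c" by (simp add: c \<phi>_scaleC)
  have "cnj c = c" using \<phi>_star[of "star x * x"] by (simp add: phi star_mult star_star)
  then obtain t where t: "c = of_real t" by (metis Reals_cases Reals_cnj_iff)
  have "t \<ge> 0"
  proof (rule ccontr)
    assume "\<not> t \<ge> 0"
    \<comment> \<open>The coefficient of z* z is cmod (\<alpha> + \<beta>) ^ 2 - cmod \<beta> ^ 2 + t, which vanishes for \<alpha> + \<beta> = r.\<close>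
    define r where "r = sqrt ((cmod \<beta>)\<^sup>2 - t)"
    define \<alpha> where "\<alpha> = of_real r - \<beta>"
    have r2: "complex_of_real r * of_real r = \<beta> * cnj \<beta> - of_real t"
    proof -
      have "0 \<le> (cmod \<beta>)\<^sup>2 - t" using \<open>\<not> t \<ge> 0\<close> by (smt (verit) zero_le_power2)
      then have "r * r = (cmod \<beta>)\<^sup>2 - t" by (simp add: r_def)
      then have "complex_of_real r * of_real r = of_real ((cmod \<beta>)\<^sup>2 - t)" by (metis of_real_mult)
      then show ?thesis by (simp add: complex_norm_square[symmetric] del: of_real_power)
    qed
    define z where "z = \<alpha> *\<^sub>C e m + y"
    have "star z * z = (cnj \<alpha> * \<alpha> + cnj \<alpha> * \<beta> + \<alpha> * cnj \<beta> + of_real t) *\<^sub>C e m"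
      by (simp add: z_def star_add star_scaleC algebra_simps mult_scaleC_left mult_scaleC_right
          scaleC_scaleC scaleC_add_left \<beta> \<beta>' c t)
    also have "cnj \<alpha> * \<alpha> + cnj \<alpha> * \<beta> + \<alpha> * cnj \<beta> + of_real t = 0"
      using r2 by (simp add: \<alpha>_def algebra_simps)
    finally have "z = 0" by (simp add: star_mult_eq_0_iff)
    then have y: "y = (- \<alpha>) *\<^sub>C e m" by (simp add: z_def scaleC_minus_left eq_neg_iff_add_eq_0 add.commute)
    have "star y * y = (cnj \<alpha> * \<alpha>) *\<^sub>C e m"
      unfolding y by (simp only: star_scaleC mult_scaleC_left mult_scaleC_right scaleC_scaleC e_star e_idem) simp
    then have "(of_real t - cnj \<alpha> * \<alpha>) *\<^sub>C e m = 0" using c t by (simp add: scaleC_diff_left)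
    then have "complex_of_real t = of_real ((cmod \<alpha>)\<^sup>2)"
      using nonzero[of m] by (simp add: scaleC_eq_0_iff complex_norm_square mult.commute del: of_real_power)
    then have "t = (cmod \<alpha>)\<^sup>2" by (simp only: of_real_eq_iff)
    then show False using \<open>\<not> t \<ge> 0\<close> by simp
  qed
  then show ?thesis by (simp add: phi t)
qed

lemma \<phi>_positive: "\<phi> (star x * x) = of_real (cmod (\<phi> (star x * x)))"
proof -
  obtain y N where y: "\<And>k. y k \<in> V (N k)" "y \<longlonglongrightarrow> x" by (rule approximation[of x], blast)
  have lim: "(\<lambda>k. \<phi> (star (y k) * y k)) \<longlonglongrightarrow> \<phi> (star x * x)"
    by (intro bounded_linear.tendsto[OF bounded_linear_\<phi>] tendsto_mult tendsto_star y(2))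
  have "(\<lambda>k. of_real (cmod (\<phi> (star (y k) * y k)))) \<longlonglongrightarrow> complex_of_real (cmod (\<phi> (star x * x)))"
    using lim by (intro tendsto_of_real tendsto_norm)
  then have "(\<lambda>k. \<phi> (star (y k) * y k)) \<longlonglongrightarrow> complex_of_real (cmod (\<phi> (star x * x)))"
    unfolding \<phi>_positive_dense[OF y(1), symmetric] .
  then show ?thesis by (rule LIMSEQ_unique[OF lim])
qed

definition seminorm :: "'a \<Rightarrow> real" where
  "seminorm x = sqrt (Re (\<phi> (star x * x)))"

lemma Re_\<phi>: "Re (\<phi> (star x * x)) = cmod (\<phi> (star x * x))"
  using \<phi>_positive[of x] by (metis Re_complex_of_real)

text \<open>
  The Hilbert seminorm is the quotient seminorm modulo its own null space: \<open>x\<close> and \<open>x e\<^sub>n\<close> differ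
  by a null vector, and \<open>norm (x * e n)\<close> decreases to the Hilbert seminorm of \<open>x\<close>. The bounds below
  and the completeness of the representation space all come from here.
\<close>

lemma seminorm_tendsto: "(\<lambda>n. norm (x * e n)) \<longlonglongrightarrow> seminorm x"
proof -
  have "norm (x * e n) = sqrt (norm (e n * (star x * x) * e n))" for n
    using norm_star_mult[of "x * e n"] by (simp add: star_mult mult.assoc)
  then show ?thesis
    using tendsto_real_sqrt[OF norm_compression_tendsto[of "star x * x"]]
    by (simp add: seminorm_def Re_\<phi>)
qed

lemma seminorm_nonneg: "0 \<le> seminorm x"
  by (simp add: seminorm_def Re_\<phi>)

lemma norm_mult_e_le: "norm (x * e n) \<le> norm x"
  using norm_mult_ineq[of x "e n"] by simp

lemma seminorm_le_norm: "seminorm x \<le> norm x"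
  using norm_mult_e_le by (intro LIMSEQ_le_const2[OF seminorm_tendsto]) blast

lemma seminorm_triangle: "seminorm (x + y) \<le> seminorm x + seminorm y"
  by (rule LIMSEQ_le[OF seminorm_tendsto tendsto_add[OF seminorm_tendsto seminorm_tendsto]])
     (auto simp: distrib_right norm_triangle_ineq)

lemma seminorm_mult: "seminorm (a * x) \<le> norm a * seminorm x"
  by (rule LIMSEQ_le[OF seminorm_tendsto tendsto_mult_left[OF seminorm_tendsto]])
     (auto simp: mult.assoc norm_mult_ineq)

lemma \<phi>_eq_0_if_seminorm_eq_0:
  assumes "seminorm x = 0"
  shows "\<phi> (b * x) = 0"
proof -
  have "(\<lambda>n. norm b * norm (x * e n)) \<longlonglongrightarrow> norm b * 0"
    using seminorm_tendsto[of x] assms by (intro tendsto_intros) simp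
  moreover have "norm (e n * (b * x) * e n) \<le> norm b * norm (x * e n)" for n
    using norm_mult3[of "e n" b "x * e n"] by (simp add: mult.assoc)
  ultimately have "cmod (\<phi> (b * x)) \<le> norm b * 0"
    by (intro LIMSEQ_le[OF norm_compression_tendsto]) auto
  then show ?thesis by simp
qed

section \<open>The representation of the excised state\<close>

text \<open>
  The class of \<open>x\<close> modulo the null vectors of \<open>\<phi>\<close>, represented by its inner products with all other
  classes. With functions instead of cosets the vector space operations are pointwise, and only
  the inner product has to choose a representative.
\<close>

definition gns_vec :: "'a \<Rightarrow> 'a \<Rightarrow> complex" where
  "gns_vec x = (\<lambda>b. \<phi> (star b * x))"

definition gns_space :: "('a \<Rightarrow> complex) hspace" where
  "gns_space =
     \<lparr>hcarrier = range gns_vec, hadd = (\<lambda>u v b. u b + v b), hzero = (\<lambda>b. 0),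
      hscale = (\<lambda>c u b. c * u b), hinner = (\<lambda>u v. u (SOME y. gns_vec y = v))\<rparr>"

definition gns_rep :: "'a \<Rightarrow> ('a \<Rightarrow> complex) \<Rightarrow> 'a \<Rightarrow> complex" where
  "gns_rep a u = (\<lambda>b. u (star a * b))"

lemma gns_vec_eq_iff: "gns_vec x = gns_vec y \<longleftrightarrow> seminorm (x - y) = 0"
proof
  assume "gns_vec x = gns_vec y"
  then have "\<phi> (star (x - y) * (x - y)) = 0"
    by (simp add: gns_vec_def fun_eq_iff right_diff_distrib[of "star (x - y)"] \<phi>_diff)
  then show "seminorm (x - y) = 0" by (simp add: seminorm_def)
next
  assume "seminorm (x - y) = 0"
  then have "\<phi> (star b * (x - y)) = 0" for b by (rule \<phi>_eq_0_if_seminorm_eq_0)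
  then show "gns_vec x = gns_vec y" by (simp add: gns_vec_def fun_eq_iff right_diff_distrib \<phi>_diff)
qed

lemma gns_simps:
  "hcarrier gns_space = range gns_vec" "hzero gns_space = gns_vec 0"
  "hadd gns_space (gns_vec x) (gns_vec y) = gns_vec (x + y)"
  "hscale gns_space c (gns_vec x) = gns_vec (c *\<^sub>C x)"
  "hinner gns_space (gns_vec x) (gns_vec y) = \<phi> (star y * x)"
  "gns_rep a (gns_vec x) = gns_vec (a * x)"
proof -
  have "gns_vec (SOME z. gns_vec z = gns_vec y) = gns_vec y" by (rule someI[of _ y]) simp
  then have "cnj (\<phi> (star x * (SOME z. gns_vec z = gns_vec y))) = cnj (\<phi> (star x * y))"
    by (metis gns_vec_def)
  then show "hinner gns_space (gns_vec x) (gns_vec y) = \<phi> (star y * x)"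
    by (simp add: gns_space_def gns_vec_def[of x] \<phi>_star[symmetric] star_mult star_star)
qed (simp_all add: gns_space_def gns_rep_def gns_vec_def fun_eq_iff distrib_left \<phi>_add mult_scaleC_right
    \<phi>_scaleC star_mult star_star mult.assoc)

lemma hnorm_vec: "hnorm gns_space (gns_vec x) = seminorm x"
  by (simp add: hnorm_def gns_simps seminorm_def)

lemma hdist_vec: "hdist gns_space (gns_vec x) (gns_vec y) = seminorm (x - y)"
proof -
  have "x + (- 1) *\<^sub>C y = x - y" by (simp add: scaleC_minus_left scaleC_one)
  then show ?thesis by (simp add: hdist_def gns_simps hnorm_vec)
qed

lemma seminorm_minus_commute: "seminorm (x - y) = seminorm (y - x)"
proof -
  have "star (x - y) * (x - y) = star (y - x) * (y - x)" by (simp add: star_diff algebra_simps)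
  then show ?thesis by (simp add: seminorm_def)
qed

lemma gns_metric: "Metric_space (range gns_vec) (hdist gns_space)"
proof
  show "0 \<le> hdist gns_space u v" for u v
    by (cases "u \<in> range gns_vec \<and> v \<in> range gns_vec")
       (auto simp: hdist_vec seminorm_nonneg, auto simp: hdist_def gns_simps)
  show "hdist gns_space u v = hdist gns_space v u" for u v
    by (cases "u \<in> range gns_vec \<and> v \<in> range gns_vec")
       (auto simp: hdist_vec seminorm_minus_commute, auto simp: hdist_def gns_simps)
  show "hdist gns_space u v = 0 \<longleftrightarrow> u = v" if "u \<in> range gns_vec" "v \<in> range gns_vec" for u v
    using that by (auto simp: hdist_vec gns_vec_eq_iff)
  show "hdist gns_space u w \<le> hdist gns_space u v + hdist gns_space v w"
    if "u \<in> range gns_vec" "v \<in> range gns_vec" "w \<in> range gns_vec" for u v w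
    using that seminorm_triangle[of "x - y" "y - z" for x y z] by (auto simp: hdist_vec)
qed

lemma small_representative:
  assumes "seminorm x < t"
  obtains w where "gns_vec w = gns_vec x" "norm w < t"
proof -
  have "\<forall>\<^sub>F n in sequentially. norm (x * e n) < t"
    using order_tendstoD(2)[OF seminorm_tendsto assms] .
  then obtain n where n: "norm (x * e n) < t"
    using eventually_happens'[OF sequentially_bot] by blast
  have "gns_vec (x * e n) = gns_vec x" by (simp add: gns_vec_def \<phi>_absorb(1) flip: mult.assoc)
  then show ?thesis using that n by blast
qed

text \<open>
  Since the Hilbert norm is a quotient norm of the algebra norm, no completion is needed: the
  increments of a rapidly convergent subsequence have representatives of summable norm,
  and their sum in the algebra represents the limit.
\<close>

lemma gns_complete: "Metric_space.mcomplete (range gns_vec) (hdist gns_space)"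
proof -
  interpret m: Metric_space "range gns_vec" "hdist gns_space" by (rule gns_metric)
  show ?thesis
    unfolding m.mcomplete_def
  proof (intro allI impI)
    fix \<sigma> assume \<sigma>: "m.MCauchy \<sigma>"
    then have "\<forall>n. \<exists>x. \<sigma> n = gns_vec x" by (auto simp: m.MCauchy_def image_subset_iff)
    then obtain x where x: "\<And>n. \<sigma> n = gns_vec (x n)" by metis
    have "\<forall>k. \<exists>N. \<forall>n n'. N \<le> n \<longrightarrow> N \<le> n' \<longrightarrow> seminorm (x n - x n') < (1 / 2) ^ k"
    proof
      fix k :: nat
      have "(1 / 2 :: real) ^ k > 0" by simp
      then show "\<exists>N. \<forall>n n'. N \<le> n \<longrightarrow> N \<le> n' \<longrightarrow> seminorm (x n - x n') < (1 / 2) ^ k"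
        using \<sigma> unfolding m.MCauchy_def x hdist_vec by blast
    qed
    then obtain N where N: "\<And>k n n'. N k \<le> n \<Longrightarrow> N k \<le> n' \<Longrightarrow> seminorm (x n - x n') < (1 / 2) ^ k"
      by metis
    \<comment> \<open>A strictly increasing choice of indices with N k below r k.\<close>
    define r where "r k = (\<Sum>i\<le>k. N i + 1)" for k
    have r: "strict_mono r" by (rule strict_monoI_Suc) (simp add: r_def)
    have rN: "N k \<le> r k" for k
      using member_le_sum[of k "{..k}" "\<lambda>i. N i + 1"] by (simp add: r_def)
    have "seminorm (x (r (Suc k)) - x (r k)) < (1 / 2) ^ k" for k
      using N[of k] rN[of k] strict_monoD[OF r, of k "Suc k"] by simp
    then have "\<forall>k. \<exists>w. gns_vec w = gns_vec (x (r (Suc k)) - x (r k)) \<and> norm w < (1 / 2) ^ k"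
      using small_representative by metis
    then obtain w where w: "\<And>k. gns_vec (w k) = gns_vec (x (r (Suc k)) - x (r k))" "\<And>k. norm (w k) < (1 / 2) ^ k"
      by metis
    have summable: "summable w"
      by (rule summable_comparison_test[OF _ summable_geometric[of "1 / 2 :: real"]])
         (use w(2) in \<open>auto intro: less_imp_le\<close>)
    define l where "l = x (r 0) + suminf w"
    have partial: "gns_vec (x (r k)) = gns_vec (x (r 0) + (\<Sum>i<k. w i))" for k
    proof (induction k)
      case (Suc k)
      have "gns_vec (x (r (Suc k))) = hadd gns_space (gns_vec (x (r k))) (gns_vec (x (r (Suc k)) - x (r k)))"
        by (simp add: gns_simps)
      also have "\<dots> = gns_vec (x (r 0) + (\<Sum>i<Suc k. w i))"
        unfolding Suc w(1)[symmetric] gns_simps by (simp add: add.assoc)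
      finally show ?case .
    qed simp
    have bound: "hdist gns_space (\<sigma> (r k)) (gns_vec l) \<le> norm ((\<Sum>i<k. w i) - suminf w)" for k
      using seminorm_le_norm[of "(\<Sum>i<k. w i) - suminf w"]
      by (simp add: x partial hdist_vec l_def)
    have "(\<lambda>k. norm ((\<Sum>i<k. w i) - suminf w)) \<longlonglongrightarrow> 0"
      using summable_LIMSEQ[OF summable] by (intro tendsto_norm_zero LIM_zero)
    then have "(\<lambda>k. hdist gns_space (\<sigma> (r k)) (gns_vec l)) \<longlonglongrightarrow> 0"
      using bound by (intro Lim_null_comparison[of "\<lambda>k. hdist gns_space (\<sigma> (r k)) (gns_vec l)"]) (auto simp: m.nonneg)
    then have "limitin m.mtopology (\<sigma> \<circ> r) (gns_vec l) sequentially"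
      by (subst m.limitin_metric_dist_null) (auto simp: x)
    then show "\<exists>x. limitin m.mtopology \<sigma> x sequentially"
      using m.MCauchy_convergent_subsequence[OF \<sigma> r] by blast
  qed
qed

lemma gns_hilbert: "hilbert_space gns_space"
proof
  show "Metric_space.mcomplete (hcarrier gns_space) (hdist gns_space)"
    using gns_complete by (simp add: gns_simps)
  show "\<exists>v\<in>hcarrier gns_space. hadd gns_space u v = hzero gns_space" if u: "u \<in> hcarrier gns_space" for u
  proof -
    obtain x where "u = gns_vec x" using u by (auto simp: gns_simps)
    then show ?thesis by (intro bexI[of _ "gns_vec (- x)"]) (simp_all add: gns_simps)
  qed
  show "hinner gns_space u v = cnj (hinner gns_space v u)"
    if uv: "u \<in> hcarrier gns_space" "v \<in> hcarrier gns_space" for u v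
  proof -
    obtain x y where "u = gns_vec x" "v = gns_vec y" using uv by (auto simp: gns_simps)
    then show ?thesis by (simp add: gns_simps \<phi>_star[symmetric] star_mult star_star)
  qed
  show "u = hzero gns_space" if "u \<in> hcarrier gns_space" "hinner gns_space u u = 0" for u
    using that by (auto simp: gns_simps gns_vec_eq_iff seminorm_def)
  show "0 \<le> Re (hinner gns_space u u)" if "u \<in> hcarrier gns_space" for u
    using that by (auto simp: gns_simps Re_\<phi>)
qed (auto simp: gns_simps scaleC_one scaleC_scaleC scaleC_add_left scaleC_add_right distrib_left \<phi>_add
    mult_scaleC_right \<phi>_scaleC add_ac)

sublocale gns: star_rep gns_space gns_rep
proof (intro star_rep.intro gns_hilbert star_rep_axioms.intro)
  show "\<exists>K. \<forall>u\<in>hcarrier gns_space. hnorm gns_space (gns_rep a u) \<le> K * hnorm gns_space u" for a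
    using seminorm_mult[of a] by (intro exI[of _ "norm a"]) (auto simp: gns_simps hnorm_vec)
  show "hinner gns_space (gns_rep (star a) u) v = hinner gns_space u (gns_rep a v)"
    if "u \<in> hcarrier gns_space" "v \<in> hcarrier gns_space" for a u v
    using that by (auto simp: gns_simps star_mult mult.assoc)
qed (auto simp: gns_simps distrib_left distrib_right mult_scaleC_left mult_scaleC_right mult.assoc)

lemma gns_vec_e: "gns_vec (e n) = gns_vec (e 0)"
proof -
  have "\<phi> (star b * e n) = \<phi> (star b * e 0)" for b using \<phi>_absorb(1) by metis
  then show ?thesis by (simp add: gns_vec_def)
qed

lemma gns_vec_mult_e: "gns_vec (x * e n) = gns_vec x"
  by (simp add: gns_vec_def \<phi>_absorb(1) flip: mult.assoc)

text \<open>
  The operators \<open>\<pi>(e\<^sub>n)\<close> converge strongly to the projection onto the line of the cyclic vector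
  \<open>\<xi> = gns_vec (e 0)\<close>, so \<open>\<phi>(x) \<xi>\<close> belongs to every closed invariant subspace \<open>M\<close> that contains the class
  of \<open>x\<close>. Either some such \<open>\<phi>(x)\<close> is non-zero and \<open>M\<close> contains the cyclic vector, or \<open>\<phi>\<close> vanishes on
  \<open>x\<^sup>* x\<close> for every class in \<open>M\<close> and \<open>M\<close> is zero.
\<close>

lemma gns_irreducible: "irreducible_rep gns_space gns_rep"
  unfolding irreducible_rep_def
proof (intro conjI allI impI gns.star_rep_axioms)
  fix M assume asm: "closed_hsubspace gns_space M \<and> (\<forall>a. \<forall>u\<in>M. gns_rep a u \<in> M)"
  have closedM: "closedin gns.metric.mtopology M"
    and scaleM: "\<And>c u. u \<in> M \<Longrightarrow> hscale gns_space c u \<in> M"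
    and inv: "\<And>a u. u \<in> M \<Longrightarrow> gns_rep a u \<in> M" and zeroM: "gns_vec 0 \<in> M"
    using asm by (auto simp: closed_hsubspace_def gns_simps)
  have subM: "M \<subseteq> range gns_vec" using closedin_subset[OF closedM, unfolded gns.metric.topspace_mtopology] by (simp add: gns_simps)
  have proj: "gns_vec (\<phi> x *\<^sub>C e 0) \<in> M" if x: "gns_vec x \<in> M" for x
  proof -
    have bound: "hdist gns_space (gns_vec (e n * x)) (gns_vec (\<phi> x *\<^sub>C e 0)) \<le> norm (e n * x * e n - \<phi> x *\<^sub>C e n)" for n
    proof -
      have "gns_vec (\<phi> x *\<^sub>C e 0) = gns_vec (\<phi> x *\<^sub>C e n)"
        using gns_vec_e[of n] by (metis gns_simps(4))
      moreover have "gns_vec (e n * x) = gns_vec (e n * x * e n)" by (simp add: gns_vec_mult_e)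
      ultimately show ?thesis by (simp only: hdist_vec seminorm_le_norm)
    qed
    have "(\<lambda>n. hdist gns_space (gns_vec (e n * x)) (gns_vec (\<phi> x *\<^sub>C e 0))) \<longlonglongrightarrow> 0"
      using tendsto_norm_zero[OF \<phi>_excises[of x]] bound
      by (intro Lim_null_comparison[of "\<lambda>n. hdist gns_space (gns_vec (e n * x)) (gns_vec (\<phi> x *\<^sub>C e 0))"]) auto
    then have "limitin gns.metric.mtopology (\<lambda>n. gns_vec (e n * x)) (gns_vec (\<phi> x *\<^sub>C e 0)) sequentially"
      by (subst gns.metric.limitin_metric_dist_null) (auto simp: gns_simps)
    moreover have "range (\<lambda>n. gns_vec (e n * x)) \<subseteq> M" using inv[OF x] by (auto simp: gns_simps)
    ultimately show ?thesis
      using closedM unfolding gns.metric.metric_closedin_iff_sequentially_closed by blast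
  qed
  show "M = {hzero gns_space} \<or> M = hcarrier gns_space"
  proof (cases "\<exists>x. gns_vec x \<in> M \<and> \<phi> x \<noteq> 0")
    case True
    then obtain x where x: "gns_vec x \<in> M" "\<phi> x \<noteq> 0" by blast
    have "hscale gns_space (1 / \<phi> x) (gns_vec (\<phi> x *\<^sub>C e 0)) \<in> M" using proj[OF x(1)] by (rule scaleM)
    then have "gns_vec (e 0) \<in> M" using x(2) by (simp add: gns_simps scaleC_scaleC scaleC_one)
    then have "gns_vec a \<in> M" for a using inv[of "gns_vec (e 0)" a] by (simp add: gns_simps gns_vec_mult_e)
    then show ?thesis using subM by (auto simp: gns_simps)
  next
    case False
    have "gns_vec x = gns_vec 0" if x: "gns_vec x \<in> M" for x
    proof -
      have "gns_vec (star x * x) \<in> M" using inv[OF x, of "star x"] by (simp add: gns_simps)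
      then show ?thesis using False by (auto simp: gns_vec_eq_iff seminorm_def)
    qed
    then have "M = {gns_vec 0}" using subM zeroM by blast
    then show ?thesis by (simp add: gns_simps(2))
  qed
qed

text \<open>
  Otherwise \<open>e\<^sub>n\<close> would for large \<open>n\<close> be at distance less than 1 from the element \<open>e\<^sub>n x e\<^sub>n / \<phi>(x)\<close> of \<open>I\<close>.
\<close>

lemma \<phi>_vanishes_on_ideal:
  assumes I: "I \<in> ideals" and e: "\<And>n. e n \<notin> I" and x: "x \<in> I"
  shows "\<phi> x = 0"
proof (rule ccontr)
  assume nz: "\<phi> x \<noteq> 0"
  obtain n where n: "norm (e n * x * e n - \<phi> x *\<^sub>C e n) < cmod (\<phi> x)"
    using LIMSEQ_D[OF \<phi>_excises[of x], of "cmod (\<phi> x)"] nz unfolding diff_0_right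
    by (meson order_refl zero_less_norm_iff)
  define y where "y = (1 / \<phi> x) *\<^sub>C (e n * x * e n)"
  have "e n - y = (- (1 / \<phi> x)) *\<^sub>C (e n * x * e n - \<phi> x *\<^sub>C e n)"
    using nz by (simp add: y_def scaleC_diff_right scaleC_scaleC scaleC_one scaleC_minus_left)
  then have "norm (e n - y) < 1" using n nz by (simp add: norm_scaleC norm_divide)
  moreover have "y \<in> I" using x by (simp add: y_def ideal_closed_under[OF I] ideal_vector[OF I])
  ultimately show False using projection_near_ideal[OF I projection] e by blast
qed

lemma ideal_subset_gns_kernel:
  assumes I: "I \<in> ideals" and e: "\<And>n. e n \<notin> I"
  shows "I \<subseteq> rep_kernel gns_space gns_rep"
proof
  fix a assume a: "a \<in> I"
  have "gns_vec (a * x) = gns_vec 0" for x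
    unfolding gns_vec_def
    using a by (auto simp: ideal_closed_under[OF I] intro!: \<phi>_vanishes_on_ideal[OF I e])
  then show "a \<in> rep_kernel gns_space gns_rep" by (auto simp: rep_kernel_def gns_simps)
qed

lemma not_in_gns_kernel:
  assumes "f * e 0 = e 0"
  shows "f \<notin> rep_kernel gns_space gns_rep"
proof
  assume "f \<in> rep_kernel gns_space gns_rep"
  then have "gns_rep f (gns_vec (e 0)) = gns_vec 0" by (simp add: rep_kernel_def gns_simps(1,2))
  then have "gns_vec (e 0) = gns_vec 0" by (simp add: gns_simps assms)
  then have "\<phi> (star (e 0) * e 0) = \<phi> (star (e 0) * 0)" by (metis gns_vec_def)
  then show False by simp
qed

end

section \<open>Ideals of AF algebras\<close>

locale af_filtration =
  fixes U :: "nat \<Rightarrow> 'a::cstar_algebra set"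
  assumes subalgebra: "cstar_subalgebra (U n)" and finite_dim: "finite_dim (U n)"
    and increasing: "incseq U" and dense: "closure (\<Union>n. U n) = UNIV"
begin

text \<open>
  Below a projection \<open>f\<close> outside \<open>I\<close> one finds a decreasing sequence of minimal projections of
  successive stages that all stay outside \<open>I\<close>. The state that they excise vanishes on \<open>I\<close>, and \<open>f\<close>
  fixes the cyclic vector of its representation, whose kernel is the required primitive ideal.
\<close>

lemma primitive_ideal_separation:
  assumes I: "I \<in> ideals" and f: "f \<in> projections (U m)" "f \<notin> I"
  obtains P where "P \<in> Prim" "I \<subseteq> P" "f \<notin> P"
proof -
  \<comment> \<open>The sequence starts at the stage that contains f.\<close>
  define V where "V n = U (n + m)" for n
  define good where "good n e \<longleftrightarrow> e \<in> projections (V n) \<and> e \<notin> I \<and> e * f = e \<and>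
    (\<forall>q\<in>projections (V n). q * e = q \<longrightarrow> q = 0 \<or> q = e)" for n e
  have V: "cstar_subalgebra (V n)" "finite_dim (V n)" "V n \<subseteq> V (Suc n)" for n
    using subalgebra finite_dim incseq_SucD[OF increasing, of "n + m"] by (simp_all add: V_def)
  have "\<exists>e. \<forall>n. good n (e n) \<and> e (Suc n) * e n = e (Suc n)"
  proof (rule dependent_nat_choice)
    show "\<exists>e. good 0 e"
      using minimal_projection_outside_ideal[OF V(1,2) I, of f 0] f unfolding good_def V_def
      by (metis add_0)
  next
    fix e n assume e: "good n e"
    then have "e \<in> projections (V (Suc n))" "e \<notin> I"
      using projections_mono[OF V(3)] by (auto simp: good_def)
    then obtain e' where e': "e' \<in> projections (V (Suc n))" "e' \<notin> I" "e' * e = e'"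
      "\<And>q. q \<in> projections (V (Suc n)) \<Longrightarrow> q * e' = q \<Longrightarrow> q = 0 \<or> q = e'"
      using minimal_projection_outside_ideal[OF V(1,2) I] by metis
    moreover have "e' * f = e'" using e' e unfolding good_def by (metis mult.assoc)
    ultimately show "\<exists>e'. good (Suc n) e' \<and> e' * e = e'" unfolding good_def by blast
  qed
  then obtain e where e: "\<And>n. good n (e n)" "\<And>n. e (Suc n) * e n = e (Suc n)" by blast
  have nz: "e n \<noteq> 0" for n using e(1)[of n] ideal_vector(1)[OF I] by (auto simp: good_def)
  interpret excising_sequence V e
  proof
    show "incseq V" using V(3) by (rule incseq_SucI)
    have "U n \<subseteq> V n" for n unfolding V_def using increasing by (simp add: incseqD)
    then have "(\<Union>n. U n) \<subseteq> (\<Union>n. V n)" by blast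
    then have "closure (\<Union>n. U n) \<subseteq> closure (\<Union>n. V n)" by (rule closure_mono)
    then show "closure (\<Union>n. V n) = UNIV" using dense by blast
    show "\<exists>c. e n * x * e n = c *\<^sub>C e n" if "x \<in> V n" for x n
      using minimal_projection_compression[OF V(1,2) _ nz _ that] e(1)[of n] by (simp add: good_def)
  qed (use V e nz in \<open>auto simp: good_def\<close>)
  have kernel: "I \<subseteq> rep_kernel gns_space gns_rep"
    using e(1) by (intro ideal_subset_gns_kernel[OF I]) (simp add: good_def)
  have "f * e 0 = e 0"
    using e(1)[of 0] absorb_commute[of "e 0" "V 0" f "U m"] f(1) by (simp add: good_def)
  then have notin: "f \<notin> rep_kernel gns_space gns_rep" by (rule not_in_gns_kernel)
  then have "rep_kernel gns_space gns_rep \<in> Prim"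
    by (intro rep_kernel_in_Prim[OF gns_irreducible]) blast
  then show ?thesis using that kernel notin by blast
qed


text \<open>
  Take \<open>w\<close> in some stage close to \<open>x\<close> and let \<open>p\<close> be the right unit of \<open>I \<inter> U n\<close>; the approximation is
  \<open>w p\<close>. The rest \<open>z = w - w p\<close> is no larger than \<open>w - x\<close>, since otherwise the top projection \<open>e\<close> of \<open>z\<close> would
  be close to \<open>I\<close>, hence in \<open>I \<inter> U n\<close>, although it is orthogonal to \<open>p\<close>. This is the usual fact that a
  finite-dimensional subalgebra modulo its intersection with \<open>I\<close> embeds isometrically in the quotient by \<open>I\<close>.
\<close>

lemma ideal_approximation:
  assumes I: "I \<in> ideals" and x: "x \<in> I" and \<epsilon>: "\<epsilon> > 0"
  obtains n y where "y \<in> I \<inter> U n" "norm (x - y) < \<epsilon>"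
proof -
  have "x \<in> closure (\<Union>n. U n)" using dense by simp
  then obtain w where w: "w \<in> (\<Union>n. U n)" "dist w x < \<epsilon> / 2"
    using closure_approachable \<epsilon> by (metis half_gt_zero)
  then obtain n where n: "w \<in> U n" by blast
  note Bc = subalgebra_closed_under[OF subalgebra] subalgebra_vector[OF subalgebra]
  obtain p where p: "p \<in> projections (U n)" "p \<in> I" "\<And>y. y \<in> I \<inter> U n \<Longrightarrow> y * p = y"
    using ideal_has_right_unit[OF subalgebra[of n] finite_dim I] by blast
  note pD = projectionsD[OF p(1)]
  define z where "z = w - w * p"
  have zU: "z \<in> U n" unfolding z_def by (intro Bc n pD)
  have zp: "z * p = 0" by (simp add: z_def left_diff_distrib mult.assoc pD)
  have "norm z \<le> norm (w - x)"
  proof (rule ccontr)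
    assume "\<not> norm z \<le> norm (w - x)"
    then have less: "norm (w - x) < norm z" by simp
    then have z0: "z \<noteq> 0" by auto
    obtain e g where e: "e \<in> projections (U n)" "e \<noteq> 0" "norm g \<le> 1"
      "g * (star z * z) = (norm z)\<^sup>2 *\<^sub>R e"
      using top_projection[OF subalgebra finite_dim zU z0] by metis
    note eD = projectionsD[OF e(1)]
    define r where "r = 1 / (norm z)\<^sup>2"
    have e_eq: "e = r *\<^sub>R (g * star z * z)" using e(4) z0 by (simp add: r_def mult.assoc)
    have ep: "e * p = 0" by (simp add: e_eq mult.assoc zp)
    then have pe: "p * e = 0" using star_mult[of e p] by (simp add: pD eD)
    have "z * e = w * e" by (simp add: z_def left_diff_distrib mult.assoc pe)
    then have "e = r *\<^sub>R (g * star z * w * e)"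
      using eD(3) by (subst (asm) (1) e_eq) (simp add: mult.assoc)
    then have "e - r *\<^sub>R (g * star z * x * e) = r *\<^sub>R (g * star z * (w - x) * e)"
      by (simp add: right_diff_distrib left_diff_distrib scaleR_diff_right)
    also have "norm \<dots> \<le> r * (norm z * norm (w - x))"
    proof -
      have "norm (g * star z * (w - x) * e) \<le> norm (g * star z) * norm (w - x) * norm e" by (rule norm_mult3)
      also have "\<dots> \<le> (1 * norm z) * norm (w - x) * 1"
        using e(3) norm_projection_le[OF e(1)] norm_mult_ineq[of g "star z"]
          mult_right_mono[OF e(3), of "norm z"]
        by (intro mult_mono) (auto simp: norm_star)
      finally show ?thesis by (simp add: r_def divide_right_mono)
    qed
    also have "\<dots> < 1"
      using less z0 by (simp add: r_def power2_eq_square)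
    finally have "e \<in> I"
      using x by (intro projection_near_ideal[OF I e(1)]) (simp_all add: ideal_closed_under[OF I] ideal_vector[OF I])
    then have "e * p = e" using p(3) eD(1) by blast
    then show False using ep e(2) by simp
  qed
  moreover have eq: "x - w * p = z - (w - x)" by (simp add: z_def)
  ultimately have "norm (x - w * p) \<le> 2 * norm (w - x)"
    unfolding eq using norm_triangle_ineq4[of z "w - x"] by linarith
  then have "norm (x - w * p) < \<epsilon>" using w(2) by (simp add: dist_norm)
  moreover have "w * p \<in> I \<inter> U n" using p n pD by (simp add: ideal_closed_under[OF I] Bc)
  ultimately show ?thesis using that by blast
qed

lemma ideal_determined_by_stages:
  assumes I: "I \<in> ideals" and L: "L \<in> ideals" and stages: "\<And>n. L \<inter> U n \<subseteq> I"
  shows "L \<subseteq> I"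
proof
  fix x assume x: "x \<in> L"
  have "\<exists>y\<in>I. dist y x < \<epsilon>" if "\<epsilon> > 0" for \<epsilon>
    using ideal_approximation[OF L x that] stages by (metis dist_norm norm_minus_commute subsetD)
  then show "x \<in> I"
    using closed_approachable[OF ideal_closed_under(4)[OF I]] by blast
qed

lemma separating_projection:
  assumes I: "I \<in> ideals" and L: "L \<in> ideals" and "\<not> L \<inter> U n \<subseteq> I"
  obtains p where "p \<in> projections (U n)" "p \<in> L" "p \<notin> I"
proof -
  obtain p where p: "p \<in> projections (U n)" "p \<in> L" "\<And>x. x \<in> L \<inter> U n \<Longrightarrow> x * p = x"
    using ideal_has_right_unit[OF subalgebra[of n] finite_dim L] by blast
  have "p \<notin> I"
  proof
    assume "p \<in> I"
    then have "L \<inter> U n \<subseteq> I" using p(3) ideal_closed_under(2)[OF I] by (metis subsetI)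
    then show False using assms(3) by blast
  qed
  then show ?thesis using that p by blast
qed

lemma primitive_ideal_avoiding:
  assumes I: "I \<in> ideals" and L: "L \<in> ideals" and n: "\<not> L \<inter> U n \<subseteq> I"
  obtains P where "P \<in> Prim" "I \<subseteq> P" "\<not> L \<subseteq> P"
proof -
  obtain p where "p \<in> projections (U n)" "p \<in> L" "p \<notin> I" using separating_projection[OF assms] .
  then show ?thesis using primitive_ideal_separation[OF I] that by blast
qed

end

section \<open>Compact open sets of primitive ideals\<close>

lemma closure_ideal:
  assumes "csubspace D" and mult: "\<And>a x. x \<in> D \<Longrightarrow> a * x \<in> D \<and> x * a \<in> D"
  shows "closure D \<in> ideals"
proof -
  note Dc = csubspace_closed_under[OF assms(1)]
  have "x + y \<in> closure D" if xy: "x \<in> closure D" "y \<in> closure D" for x y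
  proof -
    obtain u v where "\<forall>n. u n \<in> D" "u \<longlonglongrightarrow> x" "\<forall>n. v n \<in> D" "v \<longlonglongrightarrow> y"
      using xy by (auto simp: closure_sequential)
    then show ?thesis
      unfolding closure_sequential by (intro exI[of _ "\<lambda>n. u n + v n"]) (auto intro: tendsto_add Dc)
  qed
  moreover have "c *\<^sub>C x \<in> closure D \<and> a * x \<in> closure D \<and> x * a \<in> closure D" if x: "x \<in> closure D" for c a x
  proof -
    obtain u where u: "\<forall>n. u n \<in> D" "u \<longlonglongrightarrow> x" using x by (auto simp: closure_sequential)
    have "\<exists>v. (\<forall>n. v n \<in> D) \<and> v \<longlonglongrightarrow> c *\<^sub>C x"
      using u by (intro exI[of _ "\<lambda>n. c *\<^sub>C u n"]) (auto intro: tendsto_scaleC_right Dc)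
    moreover have "\<exists>v. (\<forall>n. v n \<in> D) \<and> v \<longlonglongrightarrow> a * x"
      using u by (intro exI[of _ "\<lambda>n. a * u n"]) (auto intro: tendsto_mult_left mult[THEN conjunct1])
    moreover have "\<exists>v. (\<forall>n. v n \<in> D) \<and> v \<longlonglongrightarrow> x * a"
      using u by (intro exI[of _ "\<lambda>n. u n * a"]) (auto intro: tendsto_mult_right mult[THEN conjunct2])
    ultimately show ?thesis unfolding closure_sequential by blast
  qed
  moreover have "0 \<in> closure D" using Dc(1) closure_subset by blast
  ultimately show ?thesis unfolding ideals_def complex_vector.subspace_def by simp
qed

text \<open>
  The ideals generated by finite subfamilies form a directed family whose union is dense in the
  ideal generated by all, and a projection near one of them belongs to it.
\<close>

lemma projection_finitely_generated:
  fixes \<I> :: "'b \<Rightarrow> 'a::cstar_algebra set"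
  assumes p: "p \<in> projections B" and gen: "p \<in> generated_ideal (\<Union>i\<in>T. \<I> i)"
  obtains F where "finite F" "F \<subseteq> T" "p \<in> generated_ideal (\<Union>i\<in>F. \<I> i)"
proof -
  define G where "G F = generated_ideal (\<Union>i\<in>F. \<I> i)" for F
  have G: "G F \<in> ideals" for F by (simp add: G_def generated_ideal_in_ideals)
  have mono: "G E \<subseteq> G F" if "E \<subseteq> F" for E F
    unfolding G_def using that by (intro generated_ideal_mono) blast
  define D where "D = (\<Union>F\<in>{F. finite F \<and> F \<subseteq> T}. G F)"
  have D: "x \<in> D \<longleftrightarrow> (\<exists>F. finite F \<and> F \<subseteq> T \<and> x \<in> G F)" for x by (auto simp: D_def)
  have "csubspace D"
    unfolding complex_vector.subspace_def
  proof (intro conjI ballI allI)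
    show "0 \<in> D" using ideal_vector(1)[OF G[of "{}"]] unfolding D by blast
    fix x assume "x \<in> D"
    then obtain E where E: "finite E" "E \<subseteq> T" "x \<in> G E" using D by blast
    show "c *\<^sub>C x \<in> D" for c using E ideal_vector(4)[OF G] unfolding D by blast
    fix y assume "y \<in> D"
    then obtain F where F: "finite F" "F \<subseteq> T" "y \<in> G F" using D by blast
    have "x \<in> G (E \<union> F)" "y \<in> G (E \<union> F)" using E F mono by (meson Un_upper1 Un_upper2 subsetD)+
    then have "x + y \<in> G (E \<union> F)" by (rule ideal_vector(2)[OF G])
    then show "x + y \<in> D" using E F unfolding D by (meson finite_UnI Un_least)
  qed
  moreover have "a * x \<in> D \<and> x * a \<in> D" if "x \<in> D" for a x
    using that ideal_closed_under(2,3)[OF G] unfolding D by meson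
  ultimately have cl: "closure D \<in> ideals" by (rule closure_ideal)
  have "\<I> i \<subseteq> D" if "i \<in> T" for i
    using that generated_ideal_superset[of "\<I> i"] unfolding D_def G_def
    by (intro order_trans[OF _ UN_upper[of "{i}"]]) auto
  then have "(\<Union>i\<in>T. \<I> i) \<subseteq> closure D" using closure_subset by blast
  then have "p \<in> closure D" using gen generated_ideal_subset_iff[OF cl] by blast
  then obtain y where "y \<in> D" "dist y p < 1" using closure_approachable zero_less_one by blast
  then obtain F where F: "finite F" "F \<subseteq> T" "y \<in> G F" "norm (p - y) < 1"
    using D by (auto simp: dist_norm norm_minus_commute)
  then have "p \<in> G F" using projection_near_ideal[OF G p] by blast
  then show ?thesis using that F by (simp add: G_def)
qed

lemma openin_jacobson_not_containing:
  "openin jacobson_topology {P \<in> Prim. \<not> X \<subseteq> P}"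
proof -
  have "{P \<in> Prim. \<not> X \<subseteq> P} = Prim - prim_hull (generated_ideal X)"
    by (auto simp: prim_hull_generated) (auto simp: prim_hull_def)
  then show ?thesis using openin_jacobson generated_ideal_in_ideals by blast
qed

text \<open>
  A family of open sets, given by ideals \<open>\<I> W\<close>, covers the primitive ideals without \<open>p\<close> only if \<open>p\<close> lies in
  the ideal generated by the \<open>\<I> W\<close>, by \<open>primitive_ideal_separation\<close>; then \<open>p\<close> lies in the ideal generated by finitely
  many of them, and these already cover.
\<close>

lemma (in af_filtration) compactin_jacobson_projection:
  assumes p: "p \<in> projections (U n)"
  shows "compactin jacobson_topology {P \<in> Prim. p \<notin> P}"
  unfolding compactin_def
proof (intro conjI allI impI)
  show "{P \<in> Prim. p \<notin> P} \<subseteq> topspace jacobson_topology" by (auto simp: topspace_jacobson)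
  fix \<W> :: "'a set set set"
  assume W: "(\<forall>W\<in>\<W>. openin jacobson_topology W) \<and> {P \<in> Prim. p \<notin> P} \<subseteq> \<Union>\<W>"
  then have "\<forall>W\<in>\<W>. \<exists>I. W = Prim - prim_hull I" by (auto simp: openin_jacobson)
  then obtain \<I> where I: "\<And>W. W \<in> \<W> \<Longrightarrow> W = Prim - prim_hull (\<I> W)" by metis
  let ?gen = "\<lambda>F. generated_ideal (\<Union>W\<in>F. \<I> W)"
  have gen: "p \<in> ?gen \<W>"
  proof (rule ccontr)
    assume "p \<notin> ?gen \<W>"
    then obtain P where P: "P \<in> Prim" "?gen \<W> \<subseteq> P" "p \<notin> P"
      using primitive_ideal_separation[OF generated_ideal_in_ideals p] by metis
    then obtain V where V: "V \<in> \<W>" "P \<in> V" using W by blast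
    have "\<I> V \<subseteq> P"
      using V(1) P(2) generated_ideal_superset[of "\<Union>W\<in>\<W>. \<I> W"] by blast
    then show False using I[OF V(1)] V P(1) by (auto simp: prim_hull_def)
  qed
  obtain F where F: "finite F" "F \<subseteq> \<W>" "p \<in> ?gen F"
    using projection_finitely_generated[OF p gen] .
  have "{P \<in> Prim. p \<notin> P} \<subseteq> \<Union>F"
  proof
    fix P assume "P \<in> {P \<in> Prim. p \<notin> P}"
    then have P: "P \<in> Prim" "p \<notin> P" by auto
    then have "\<not> ?gen F \<subseteq> P" using F by blast
    then have "\<not> (\<Union>W\<in>F. \<I> W) \<subseteq> P" using generated_ideal_subset_iff P(1) Prim_subset_ideals by blast
    then obtain W where "W \<in> F" "\<not> \<I> W \<subseteq> P" by blast
    then show "P \<in> \<Union>F" using I F(2) P(1) by (auto simp: prim_hull_def)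
  qed
  then show "\<exists>F. finite F \<and> F \<subseteq> \<W> \<and> {P \<in> Prim. p \<notin> P} \<subseteq> \<Union>F" using F by blast
qed

section \<open>Comparison of the topologies\<close>

lemma openin_fell_ideal:
  fixes S :: "'a::cstar_algebra set set"
  shows "openin fell_ideal_topology S \<longleftrightarrow> S \<subseteq> ideals \<and>
    (\<forall>I\<in>S. \<exists>K F. compactin jacobson_topology K \<and> finite F \<and>
      (\<forall>A\<in>F. openin jacobson_topology A \<and> A \<noteq> {}) \<and>
      prim_hull I \<in> fell_basic jacobson_topology K F \<and>
      (\<forall>J\<in>ideals. prim_hull J \<in> fell_basic jacobson_topology K F \<longrightarrow> J \<in> S))"
    (is "_ \<longleftrightarrow> ?nbhds")
proof
  let ?basic = "\<lambda>W :: 'a set set set. \<exists>K F. compactin jacobson_topology K \<and> finite F \<and>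
    (\<forall>A\<in>F. openin jacobson_topology A \<and> A \<noteq> {}) \<and> W = fell_basic jacobson_topology K F"
  {
    assume "openin fell_ideal_topology S"
    then obtain T where T: "openin (fell_topology jacobson_topology) T" "S = prim_hull -` T \<inter> ideals"
      unfolding fell_ideal_topology_def openin_pullback_topology by blast
    obtain \<W> where \<W>: "\<W> \<subseteq> Collect ?basic" "T = \<Union>\<W>"
      using T(1) unfolding openin_fell union_of_def arbitrary_def by blast
    show ?nbhds
    proof (intro conjI ballI)
      show "S \<subseteq> ideals" using T(2) by blast
      fix I assume "I \<in> S"
      then obtain W where W: "W \<in> \<W>" "prim_hull I \<in> W" using T(2) \<W>(2) by blast
      then obtain K F where KF: "compactin jacobson_topology K" "finite F"
        "\<forall>A\<in>F. openin jacobson_topology A \<and> A \<noteq> {}" "W = fell_basic jacobson_topology K F"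
        using \<W>(1) by blast
      moreover have "J \<in> S" if "J \<in> ideals" "prim_hull J \<in> W" for J
        using that W(1) T(2) \<W>(2) by blast
      ultimately show "\<exists>K F. compactin jacobson_topology K \<and> finite F \<and>
          (\<forall>A\<in>F. openin jacobson_topology A \<and> A \<noteq> {}) \<and>
          prim_hull I \<in> fell_basic jacobson_topology K F \<and>
          (\<forall>J\<in>ideals. prim_hull J \<in> fell_basic jacobson_topology K F \<longrightarrow> J \<in> S)"
        using W(2) by (intro exI[of _ K] exI[of _ F]) simp
    qed
  next
    assume nbhds: ?nbhds
    define T where "T = \<Union>{W. ?basic W \<and> (\<forall>J\<in>ideals. prim_hull J \<in> W \<longrightarrow> J \<in> S)}"
    have "openin (fell_topology jacobson_topology) T"
      unfolding openin_fell union_of_def arbitrary_def T_def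
      by (intro exI[of _ "{W. ?basic W \<and> (\<forall>J\<in>ideals. prim_hull J \<in> W \<longrightarrow> J \<in> S)}"]) auto
    moreover have "S = prim_hull -` T \<inter> ideals"
    proof (intro equalityI subsetI)
      fix I assume "I \<in> S"
      then have "I \<in> ideals" and
        "\<exists>W. ?basic W \<and> prim_hull I \<in> W \<and> (\<forall>J\<in>ideals. prim_hull J \<in> W \<longrightarrow> J \<in> S)"
        using nbhds by blast+
      then show "I \<in> prim_hull -` T \<inter> ideals" unfolding T_def by blast
    qed (auto simp: T_def)
    ultimately show "openin fell_ideal_topology S"
      unfolding fell_ideal_topology_def openin_pullback_topology by blast
  }
qed

lemma prim_hull_in_fell_basic:
  assumes "I \<in> ideals"
  shows "prim_hull I \<in> fell_basic jacobson_topology K F \<longleftrightarrow>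
    prim_hull I \<inter> K = {} \<and> (\<forall>A\<in>F. prim_hull I \<inter> A \<noteq> {})"
  using assms by (auto simp: fell_basic_def closedin_jacobson)

context af_filtration
begin

lemma stage_agreement_mono:
  assumes "m \<le> n" "I \<inter> U n = J \<inter> U n"
  shows "I \<inter> U m = J \<inter> U m"
  using assms(2) incseqD[OF increasing assms(1)] by blast

lemma ideal_metric_less_iff:
  "ideal_metric U I J < 1 / 2 ^ n \<longleftrightarrow> I \<inter> U n = J \<inter> U n"
proof (cases "\<forall>n. I \<inter> U n = J \<inter> U n")
  case False
  define m where "m = (LEAST m. I \<inter> U m \<noteq> J \<inter> U m)"
  have m: "I \<inter> U m \<noteq> J \<inter> U m" unfolding m_def using False by (metis (mono_tags, lifting) LeastI)
  have least: "I \<inter> U k = J \<inter> U k" if "k < m" for k using not_less_Least that unfolding m_def by blast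
  have eq: "ideal_metric U I J = 1 / 2 ^ m" using False by (simp add: ideal_metric_def m_def)
  have "ideal_metric U I J < 1 / 2 ^ n \<longleftrightarrow> n < m" unfolding eq by (simp add: divide_simps)
  also have "\<dots> \<longleftrightarrow> I \<inter> U n = J \<inter> U n" using least m stage_agreement_mono by (meson not_le)
  finally show ?thesis .
qed (simp add: ideal_metric_def)

lemma ideal_metric_nonneg: "0 \<le> ideal_metric U I J"
  by (simp add: ideal_metric_def)

lemma ideal_metric_ultra:
  "ideal_metric U I L \<le> max (ideal_metric U I J) (ideal_metric U J L)"
proof (cases "\<forall>n. I \<inter> U n = L \<inter> U n")
  case False
  define m where "m = (LEAST m. I \<inter> U m \<noteq> L \<inter> U m)"
  have "I \<inter> U m \<noteq> L \<inter> U m" unfolding m_def using False by (metis (mono_tags, lifting) LeastI)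
  then have "\<not> (ideal_metric U I J < 1 / 2 ^ m \<and> ideal_metric U J L < 1 / 2 ^ m)"
    unfolding ideal_metric_less_iff by blast
  moreover have "ideal_metric U I L = 1 / 2 ^ m" using False by (simp add: ideal_metric_def m_def)
  ultimately show ?thesis by (metis le_max_iff_disj not_le)
qed (simp add: ideal_metric_def le_max_iff_disj)

lemma ideal_metric_space: "Metric_space ideals (ideal_metric U)"
proof
  show "0 \<le> ideal_metric U I J" for I J by (rule ideal_metric_nonneg)
  show "ideal_metric U I J = ideal_metric U J I" for I J by (simp add: ideal_metric_def eq_commute)
  show "ideal_metric U I J = 0 \<longleftrightarrow> I = J" if IJ: "I \<in> ideals" "J \<in> ideals" for I J
  proof
    assume "ideal_metric U I J = 0"
    then have "I \<inter> U n = J \<inter> U n" for n using ideal_metric_less_iff[of I J n] by simp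
    then show "I = J" using IJ ideal_determined_by_stages by (intro equalityI) blast+
  qed (simp add: ideal_metric_def)
  show "ideal_metric U I L \<le> ideal_metric U I J + ideal_metric U J L" for I J L
    using ideal_metric_ultra[of I L J] ideal_metric_nonneg[of I J] ideal_metric_nonneg[of J L] by linarith
qed

lemma openin_ideal_metric:
  "openin (Metric_space.mtopology ideals (ideal_metric U)) S \<longleftrightarrow>
    S \<subseteq> ideals \<and> (\<forall>I\<in>S. \<exists>n. \<forall>J\<in>ideals. J \<inter> U n = I \<inter> U n \<longrightarrow> J \<in> S)"
proof -
  interpret m: Metric_space ideals "ideal_metric U" by (rule ideal_metric_space)
  have "(\<exists>r>0. m.mball I r \<subseteq> S) \<longleftrightarrow> (\<exists>n. \<forall>J\<in>ideals. J \<inter> U n = I \<inter> U n \<longrightarrow> J \<in> S)"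
    if I: "I \<in> ideals" for I
  proof
    assume "\<exists>r>0. m.mball I r \<subseteq> S"
    then obtain r where r: "r > 0" "m.mball I r \<subseteq> S" by blast
    obtain n where "1 / 2 ^ n < r" using real_arch_pow_inv[of r "1 / 2"] r(1) by (auto simp: power_one_over)
    then have "J \<in> m.mball I r" if "J \<in> ideals" "J \<inter> U n = I \<inter> U n" for J
      using ideal_metric_less_iff[of I J n] that I by auto
    then show "\<exists>n. \<forall>J\<in>ideals. J \<inter> U n = I \<inter> U n \<longrightarrow> J \<in> S" using r(2) by blast
  next
    assume "\<exists>n. \<forall>J\<in>ideals. J \<inter> U n = I \<inter> U n \<longrightarrow> J \<in> S"
    then obtain n where n: "\<And>J. J \<in> ideals \<Longrightarrow> J \<inter> U n = I \<inter> U n \<Longrightarrow> J \<in> S" by blast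
    have "m.mball I (1 / 2 ^ n) \<subseteq> S" using n by (auto simp: ideal_metric_less_iff)
    then show "\<exists>r>0. m.mball I r \<subseteq> S" by (intro exI[of _ "1 / 2 ^ n"]) simp
  qed
  then show ?thesis unfolding m.openin_mtopology by (meson subsetD)
qed

text \<open>
  If the hull of \<open>I\<close> misses the compact set \<open>K\<close>, then finitely many of the sets of primitive ideals not
  containing \<open>I \<inter> U n\<close> cover \<open>K\<close>, because \<open>I\<close> is determined by the \<open>I \<inter> U n\<close>; so missing \<open>K\<close> depends on one
  stage. If the hull meets the open set given by an ideal \<open>L\<close>, then \<open>L \<inter> U n\<close> is not contained in \<open>I\<close> for some
  \<open>n\<close>, and this persists for all ideals that agree with \<open>I\<close> on \<open>U n\<close>.
\<close>

lemma fell_open_imp_metric_open: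
  assumes "openin fell_ideal_topology S"
  shows "openin (Metric_space.mtopology ideals (ideal_metric U)) S"
  unfolding openin_ideal_metric
proof (intro conjI ballI)
  show sub: "S \<subseteq> ideals" using assms openin_fell_ideal by blast
  fix I assume "I \<in> S"
  then have I: "I \<in> ideals" using sub by blast
  obtain K F where K: "compactin jacobson_topology K" and F: "finite F" "\<And>A. A \<in> F \<Longrightarrow> openin jacobson_topology A"
    and meets: "\<And>A. A \<in> F \<Longrightarrow> prim_hull I \<inter> A \<noteq> {}" and misses: "prim_hull I \<inter> K = {}"
    and S: "\<And>J. J \<in> ideals \<Longrightarrow> prim_hull J \<inter> K = {} \<Longrightarrow> (\<And>A. A \<in> F \<Longrightarrow> prim_hull J \<inter> A \<noteq> {}) \<Longrightarrow> J \<in> S"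
  proof -
    have "\<exists>K F. compactin jacobson_topology K \<and> finite F \<and>
      (\<forall>A\<in>F. openin jacobson_topology A \<and> A \<noteq> {}) \<and>
      prim_hull I \<in> fell_basic jacobson_topology K F \<and>
      (\<forall>J\<in>ideals. prim_hull J \<in> fell_basic jacobson_topology K F \<longrightarrow> J \<in> S)"
      using assms \<open>I \<in> S\<close> unfolding openin_fell_ideal by (elim conjE bspec)
    then obtain K F where "compactin jacobson_topology K" "finite F"
      "\<forall>A\<in>F. openin jacobson_topology A \<and> A \<noteq> {}" "prim_hull I \<in> fell_basic jacobson_topology K F"
      "\<forall>J\<in>ideals. prim_hull J \<in> fell_basic jacobson_topology K F \<longrightarrow> J \<in> S"
      by (elim exE conjE)
    then show ?thesis using prim_hull_in_fell_basic[OF I] by (intro that[of K F]) (auto simp: prim_hull_in_fell_basic)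
  qed
  have "\<exists>n. \<forall>J\<in>ideals. J \<inter> U n = I \<inter> U n \<longrightarrow> prim_hull J \<inter> K = {}"
  proof -
    define W where "W n = {P \<in> Prim. \<not> I \<inter> U n \<subseteq> P}" for n
    have "K \<subseteq> \<Union>(range W)"
    proof
      fix P assume "P \<in> K"
      then have "P \<in> Prim" "\<not> I \<subseteq> P"
        using compactin_subset_topspace[OF K] misses by (auto simp: topspace_jacobson prim_hull_def)
      then obtain n where "\<not> I \<inter> U n \<subseteq> P"
        using ideal_determined_by_stages[OF subsetD[OF Prim_subset_ideals] I] by metis
      then show "P \<in> \<Union>(range W)" using \<open>P \<in> Prim\<close> unfolding W_def by blast
    qed
    moreover have "\<forall>A\<in>range W. openin jacobson_topology A"
      using openin_jacobson_not_containing by (auto simp: W_def)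
    ultimately obtain \<F> where \<F>: "finite \<F>" "\<F> \<subseteq> range W" "K \<subseteq> \<Union>\<F>"
      using K unfolding compactin_def by meson
    then obtain N where N: "finite N" "\<F> = W ` N" by (meson finite_subset_image)
    obtain n where n: "\<forall>m\<in>N. m \<le> n" using N(1) finite_nat_set_iff_bounded_le by blast
    have "prim_hull J \<inter> K = {}" if J: "J \<in> ideals" "J \<inter> U n = I \<inter> U n" for J
    proof -
      have "P \<notin> K" if "P \<in> prim_hull J" for P
      proof
        assume "P \<in> K"
        then obtain m where m: "m \<in> N" "P \<in> W m" using \<F>(3) N(2) by blast
        have "J \<inter> U m = I \<inter> U m" using stage_agreement_mono n m(1) J(2) by blast
        then show False using m(2) that by (auto simp: W_def prim_hull_def)
      qed
      then show ?thesis by blast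
    qed
    then show ?thesis by blast
  qed
  then obtain k where k: "\<forall>J\<in>ideals. J \<inter> U k = I \<inter> U k \<longrightarrow> prim_hull J \<inter> K = {}" ..
  have "\<forall>A\<in>F. \<exists>n. \<forall>J\<in>ideals. J \<inter> U n = I \<inter> U n \<longrightarrow> prim_hull J \<inter> A \<noteq> {}"
  proof
    fix A assume A: "A \<in> F"
    obtain L where L: "L \<in> ideals" "A = Prim - prim_hull L" using F(2)[OF A] openin_jacobson by blast
    have "\<not> L \<subseteq> I" using meets[OF A] L(2) by (auto simp: prim_hull_def)
    then obtain n where n: "\<not> L \<inter> U n \<subseteq> I" using ideal_determined_by_stages[OF I L(1)] by blast
    have "prim_hull J \<inter> A \<noteq> {}" if J: "J \<in> ideals" "J \<inter> U n = I \<inter> U n" for J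
    proof -
      have "\<not> L \<inter> U n \<subseteq> J" using n J(2) by blast
      then obtain P where "P \<in> Prim" "J \<subseteq> P" "\<not> L \<subseteq> P" using primitive_ideal_avoiding[OF J(1) L(1)] by blast
      then show ?thesis unfolding L(2) prim_hull_def by blast
    qed
    then show "\<exists>n. \<forall>J\<in>ideals. J \<inter> U n = I \<inter> U n \<longrightarrow> prim_hull J \<inter> A \<noteq> {}" by blast
  qed
  from bchoice[OF this] obtain d where
    d: "\<forall>A\<in>F. \<forall>J\<in>ideals. J \<inter> U (d A) = I \<inter> U (d A) \<longrightarrow> prim_hull J \<inter> A \<noteq> {}" ..
  obtain n where n: "\<forall>m\<in>insert k (d ` F). m \<le> n"
    using F(1) finite_nat_set_iff_bounded_le by (metis finite_imageI finite_insert)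
  have "J \<in> S" if J: "J \<in> ideals" "J \<inter> U n = I \<inter> U n" for J
  proof (rule S[OF J(1)])
    have agree: "J \<inter> U m = I \<inter> U m" if "m \<le> n" for m using stage_agreement_mono that J(2) by blast
    show "prim_hull J \<inter> K = {}" using k J(1) agree n by simp
    show "prim_hull J \<inter> A \<noteq> {}" if "A \<in> F" for A using d J(1) agree n that by simp
  qed
  then show "\<exists>n. \<forall>J\<in>ideals. J \<inter> U n = I \<inter> U n \<longrightarrow> J \<in> S" by blast
qed

text \<open>
  Projections at distance less than 1 lie in the same ideals, so the points of a finite net of
  the projections of \<open>U n\<close> can be used to test all of them.
\<close>

lemma finite_projections_detect_stage:
  obtains E where "finite E" "E \<subseteq> projections (U n)"
    "\<And>I J. I \<in> ideals \<Longrightarrow> J \<in> ideals \<Longrightarrow> I \<inter> E = J \<inter> E \<Longrightarrow> I \<inter> U n = J \<inter> U n"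
proof -
  obtain E where E: "finite E" "E \<subseteq> projections (U n)" "\<And>p. p \<in> projections (U n) \<Longrightarrow> \<exists>e\<in>E. norm (p - e) < 1 / 2"
    using finite_projection_net[OF subalgebra finite_dim] by metis
  have sub: "I \<inter> U n \<subseteq> J" if I: "I \<in> ideals" and J: "J \<in> ideals" and eq: "I \<inter> E = J \<inter> E" for I J
  proof (rule ccontr)
    assume "\<not> I \<inter> U n \<subseteq> J"
    then obtain p where p: "p \<in> projections (U n)" "p \<in> I" "p \<notin> J"
      using separating_projection[OF J I] by blast
    obtain e where e: "e \<in> E" "norm (p - e) < 1 / 2" using E(3)[OF p(1)] by blast
    then have "e \<in> I"
      using projection_near_ideal[OF I subsetD[OF E(2) e(1)] p(2)] by (simp add: norm_minus_commute)
    then have "e \<in> J" using eq e(1) by blast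
    then have "p \<in> J" using projection_near_ideal[OF J p(1)] e(2) by simp
    then show False using p(3) by blast
  qed
  show ?thesis using sub E by (intro that[of E]) blast+
qed

text \<open>
  Agreement with \<open>I\<close> on \<open>U n\<close> amounts to containing the projections in \<open>E \<inter> I\<close> and no projection in \<open>E - I\<close>,
  for a finite set \<open>E\<close>. An ideal contains \<open>p\<close> iff its hull misses the set \<open>W p\<close> of primitive ideals without \<open>p\<close>. As
  \<open>W p\<close> is both compact and open, it may be used in either role in a basic Fell open set.
\<close>

lemma metric_open_imp_fell_open:
  assumes "openin (Metric_space.mtopology ideals (ideal_metric U)) S"
  shows "openin fell_ideal_topology S"
  unfolding openin_fell_ideal
proof (intro conjI ballI)
  show sub: "S \<subseteq> ideals" using assms openin_ideal_metric by blast
  fix I assume "I \<in> S"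
  then have I: "I \<in> ideals" using sub by blast
  obtain n where n: "\<forall>J\<in>ideals. J \<inter> U n = I \<inter> U n \<longrightarrow> J \<in> S"
    using bspec[OF conjunct2[OF assms[unfolded openin_ideal_metric]] \<open>I \<in> S\<close>] ..
  obtain E where E: "finite E" "E \<subseteq> projections (U n)"
    "\<And>I J. I \<in> ideals \<Longrightarrow> J \<in> ideals \<Longrightarrow> I \<inter> E = J \<inter> E \<Longrightarrow> I \<inter> U n = J \<inter> U n"
    using finite_projections_detect_stage by metis
  define W where "W p = {P \<in> Prim. p \<notin> P}" for p :: 'a
  define K where "K = (\<Union>p\<in>E \<inter> I. W p)"
  define F where "F = W ` (E - I)"
  have hull_W: "prim_hull J \<inter> W p = {} \<longleftrightarrow> p \<in> J" if J: "J \<in> ideals" and p: "p \<in> E" for J p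
  proof
    assume empty: "prim_hull J \<inter> W p = {}"
    show "p \<in> J"
    proof (rule ccontr)
      assume "p \<notin> J"
      then obtain P where "P \<in> Prim" "J \<subseteq> P" "p \<notin> P"
        using primitive_ideal_separation[OF J] E(2) p by blast
      then show False using empty by (auto simp: prim_hull_def W_def)
    qed
  qed (auto simp: prim_hull_def W_def)
  have hull_basic: "prim_hull J \<in> fell_basic jacobson_topology K F \<longleftrightarrow> J \<inter> E = I \<inter> E" if J: "J \<in> ideals" for J
  proof -
    have "prim_hull J \<inter> K = {} \<longleftrightarrow> (\<forall>p\<in>E \<inter> I. p \<in> J)"
      using hull_W[OF J] unfolding K_def by blast
    moreover have "(\<forall>A\<in>F. prim_hull J \<inter> A \<noteq> {}) \<longleftrightarrow> (\<forall>p\<in>E - I. p \<notin> J)"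
      using hull_W[OF J] unfolding F_def by blast
    ultimately show ?thesis unfolding prim_hull_in_fell_basic[OF J] by blast
  qed
  have "compactin jacobson_topology K"
    unfolding K_def using E(1,2) compactin_jacobson_projection
    by (intro compactin_Union) (auto simp: W_def)
  moreover have "finite F" using E(1) by (simp add: F_def)
  moreover have "openin jacobson_topology A \<and> A \<noteq> {}" if "A \<in> F" for A
    using that hull_W[OF I] openin_jacobson_not_containing[of "{p}" for p] unfolding F_def W_def by fastforce
  moreover have "prim_hull I \<in> fell_basic jacobson_topology K F" using hull_basic[OF I] by simp
  moreover have "J \<in> S" if "J \<in> ideals" "prim_hull J \<in> fell_basic jacobson_topology K F" for J
    using that hull_basic E(3)[OF that(1) I] n by blast
  ultimately show "\<exists>K F. compactin jacobson_topology K \<and> finite F \<and>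
      (\<forall>A\<in>F. openin jacobson_topology A \<and> A \<noteq> {}) \<and>
      prim_hull I \<in> fell_basic jacobson_topology K F \<and>
      (\<forall>J\<in>ideals. prim_hull J \<in> fell_basic jacobson_topology K F \<longrightarrow> J \<in> S)"
    by blast
qed

end

theorem theorem3p22:
  fixes U :: "nat \<Rightarrow> 'a::cstar_algebra set"
  assumes "af_algebra TYPE('a)"
    and "\<And>n. cstar_subalgebra (U n)"
    and "\<And>n. finite_dim (U n)"
    and "incseq U"
    and "closure (\<Union>n. U n) = UNIV"
  shows "Metric_space (ideals :: 'a set set) (ideal_metric U) \<and>
    Metric_space.mtopology ideals (ideal_metric U) = fell_ideal_topology"
proof -
  interpret af_filtration U by (unfold_locales) (fact assms)+
  show ?thesis
    using ideal_metric_space fell_open_imp_metric_open metric_open_imp_fell_open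
    by (auto simp: topology_eq)
qed

end
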